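(* Let $A=kQ/I$ be a gentle algebra with marked ribbon surface $(\mathcal S_A,\mathcal M_A,\Gamma_A)$. Let $c=c_1c_2\cdots c_r$ be a permissible curve in $\mathcal S_A$ consecutively crossing arcs $\gamma_1,\dots,\gamma_{r-1}\in\Gamma_A$, cut by these arcs into the segments $c_1,\dots,c_r$ ($c_j$ lies between $\gamma_{j-1}$ and $\gamma_j$; $c_1$ and $c_r$ are the end segments). (1) (Case I) Suppose $c$ consecutively crosses $\gamma'=\gamma_i$ and $\gamma''=\gamma_{i+1}$, with $p=p(\gamma',\gamma'',c)$ on the right of $c$. Let $c'$ be the permissible curve which starts at $c(0^+)$, runs along $c_1\cdots c_i$ crossing exactly $\gamma_1,\dots,\gamma_i$, and then, inside the elementary polygon containing $c_{i+1}$, ends at the endpoint of $\gamma''$ other than $p$. Let $c''$ be the permissible curve which starts at the endpoint of $\gamma'$ other than $p$, runs inside the elementary polygon containing $c_{i+1}$ to $\gamma''$, and then runs along $c_{i+2}\cdots c_r$, crossing exactly $\gamma_{i+1},\dots,\gamma_{r-1}$ and ending at $c(1^-)$. Then there is an exact sequence $$0\to M(c')\to M(c)\to M(c'')\to 0 .$$ (2) (Case II) Suppose $2\le m<i<n\le r-2$, that the endpoint $p$ of $\gamma_i$ is on the left of $c$ and the endpoint $q$ of $\gamma_i$ is on the right of $c$, that $p=p(\gamma_{m-1},\gamma_m,c)=\cdots=p(\gamma_{i-1},\gamma_i,c)$ and $q=p(\gamma_i,\gamma_{i+1},c)=\cdots=p(\gamma_n,\gamma_{n+1},c)$. Let $c'$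 be the permissible curve which starts at the endpoint of $\gamma_{m-1}$ other than $p$, enters $\gamma_m$ through the elementary polygon containing $c_m$, runs along $c_{m+1}\cdots c_n$ crossing exactly $\gamma_m,\dots,\gamma_n$, and ends, inside the elementary polygon containing $c_{n+1}$, at the endpoint of $\gamma_{n+1}$ other than $q$. Let $c''_{\mathrm I}$ be the permissible curve which starts at $c(0^+)$, runs along $c_1\cdots c_{m-1}$ crossing exactly $\gamma_1,\dots,\gamma_{m-1}$, and ends, inside the elementary polygon containing $c_m$, at the endpoint of $\gamma_m$ other than $p$; let $c''_{\mathrm{II}}$ be the permissible curve which starts at the endpoint of $\gamma_n$ other than $q$, enters $\gamma_{n+1}$ through the elementary polygon containing $c_{n+1}$, and runs along $c_{n+2}\cdots c_r$ crossing exactly $\gamma_{n+1},\dots,\gamma_{r-1}$ and ending at $c(1^-)$. Then there is an exact sequence $$0\to M(c')\to M(c)\to M(c''_{\mathrm I})\oplus M(c''_{\mathrm{II}})\to 0 .$$ (3) (Case III, dual of Case II) Suppose $2\le m<i<n\le r-2$, that the endpoint $p$ of $\gamma_i$ is on the right of $c$ and the endpoint $q$ of $\gamma_i$ is on the left of $c$, that $p=p(\gamma_{m-1},\gamma_m,c)=\cdots=p(\gamma_{i-1},\gamma_i,c)$ and $q=p(\gamma_i,\gamma_{i+1},c)=\cdots=p(\gamma_n,\gamma_{n+1},c)$. Let $c''$, $c'_{\mathrm I}$, $c'_{\mathrm{II}}$ be the permissible curves obtained from $c$ by the same constructions as $c'$, $c''_{\mathrm I}$, $c''_{\mathrm{II}}$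 in (2), respectively (so $c''$ crosses exactly $\gamma_m,\dots,\gamma_n$, $c'_{\mathrm I}$ crosses exactly $\gamma_1,\dots,\gamma_{m-1}$ and $c'_{\mathrm{II}}$ crosses exactly $\gamma_{n+1},\dots,\gamma_{r-1}$). Then there is an exact sequence $$0\to M(c'_{\mathrm I})\oplus M(c'_{\mathrm{II}})\to M(c)\to M(c'')\to 0 .$$
   Context: $k$ is an algebraically closed field. $Q$ is a finite quiver; $\alpha\beta$ denotes the path "first $\alpha$, then $\beta$". $A=kQ/I$ is gentle if: $I$ is an admissible ideal generated by paths of length $2$; every vertex is the source of at most two and the target of at most two arrows; for each arrow $\beta$ there is at most one arrow $\alpha$ with $t(\alpha)=s(\beta)$, $\alpha\beta\notin I$, at most one with $t(\alpha)=s(\beta)$, $\alpha\beta\in I$, at most one with $s(\alpha)=t(\beta)$, $\beta\alpha\notin I$, and at most one with $s(\alpha)=t(\beta)$, $\beta\alpha\in I$. Modules are finitely generated right $A$-modules. Marked ribbon surface: a triple $(\mathcal S,\mathcal M,\Gamma)$ where $\mathcal S$ is an oriented connected surface with non-empty boundary, $\mathcal M$ is a finite set of marked points on $\partial\mathcal S$, and $\Gamma$ is a set of curves (arcs) with endpoints in $\mathcal M$, pairwise not intersecting in the interior of $\mathcal S$, dividing $\mathcal S$ into elementary polygons, each having exactly one side not in $\Gamma$ (this side is a boundary segment between marked points or a whole boundary component without marked points). If an elementary polygon has exactly two sides, one in $\Gamma$ and the other a boundary segment between two marked points, one extra point is added on that boundary segment; $E$ is the set of extra points. The algebra of $(\mathcal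 S,\mathcal M,\Gamma)$ is $kQ_{\mathcal S}/I_{\mathcal S}$: vertices are the arcs; for every elementary polygon with sides $u,v\in\Gamma$ such that $v$ follows $u$ counterclockwise around a common vertex of the polygon there is an arrow $u\to v$; $I_{\mathcal S}$ is generated by all compositions of two arrows $u\to v\to w$ arising from the same elementary polygon. $(\mathcal S_A,\mathcal M_A,\Gamma_A)$ is the marked ribbon surface (unique up to homotopy) whose algebra is $A$; vertices of $Q$ are identified with arcs. Permissible curves: curves $c:(0,1)\to\mathcal S\setminus\partial\mathcal S$ with endpoints $c(0^+),c(1^-)\in\mathcal M\cup E$, with minimal number of crossings with $\Gamma$ up to homotopy, such that the winding number of the end segments around any unmarked boundary component is $0$ or $1$ and, whenever $c$ consecutively crosses $u,v\in\Gamma$ (i.e. crosses $u$ and then $v$ with no crossing in between), $u$ and $v$ have a common endpoint $p(u,v,c)\in\mathcal M$ such that the segment of $c$ between $u$ and $v$ together with $u,v$ locally bounds a triangle with vertex $p(u,v,c)$. "Left" and "right" of $c$ refer to its orientation from $c(0^+)$ to $c(1^-)$. String module $M(c)$: for $c$ consecutively crossing $\gamma_1,\dots,\gamma_{r-1}$, consider the walk on the vertices $\gamma_1,\dots,\gamma_{r-1}$ in which consecutive vertices $\gamma_{j-1},\gamma_j$ are joined by the arrow $\gamma_{j-1}\to\gamma_j$ if $c$ crosses them counterclockwise around $p(\gamma_{j-1},\gamma_j,c)$ (equivalently this point is on the left of $c$), and by the formal inverse of the arrow $\gamma_j\to\gamma_{j-1}$ if this point is on the right of $c$. $M(c)$ is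 the corresponding string module: one basis vector for each position of the walk, arrows of the walk act as identity along the walk, all other actions are zero. *)

theory Defs
  imports
    "HOL-Complex_Analysis.Complex_Analysis"
    "HOL-Algebra.Module"
    "HOL-Algebra.QuotRing"
    "HOL-Algebra.Ideal_Product"
    "Graph_Theory.Digraph"
    "Graph_Theory.Arc_Walk"
begin

section \<open>Gentle algebras\<close>

text \<open>
  A quiver is a finite directed multigraph (\<open>fin_digraph\<close>), an arrow \<open>a\<close> going from \<open>tail Q a\<close> to
  \<open>head Q a\<close>. A path is a pair of a start vertex and a list of arrows in the order in which they
  are traversed, so that \<open>[a, b]\<close> is the path "first \<open>a\<close>, then \<open>b\<close>"; \<open>(v, [])\<close> is the trivial path.
\<close>

type_synonym ('v, 'e) qpath = "'v \<times> 'e list"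

definition qpaths :: "('v, 'e) pre_digraph \<Rightarrow> ('v, 'e) qpath set" where
  "qpaths Q = {(u, es). \<exists>v. pre_digraph.awalk Q u es v}"

definition path_elem :: "('v, 'e) qpath \<Rightarrow> ('v, 'e) qpath \<Rightarrow> 'k::field" where
  "path_elem w = (\<lambda>x. if x = w then 1 else 0)"

text \<open>The product is the bilinear extension of concatenation: the coefficient of \<open>fg\<close> at a path is
  the sum over all its factorisations into an initial and a final part.\<close>

definition path_algebra :: "('v, 'e) pre_digraph \<Rightarrow> (('v, 'e) qpath \<Rightarrow> 'k::field) ring" where
  "path_algebra Q = \<lparr>
     carrier = {f. finite {w. f w \<noteq> 0} \<and> {w. f w \<noteq> 0} \<subseteq> qpaths Q},
     mult = (\<lambda>f g (u, es). \<Sum>i\<le>length es.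
               f (u, take i es) * g (pre_digraph.awlast Q u (take i es), drop i es)),
     one = (\<lambda>(u, es). if u \<in> verts Q \<and> es = [] then 1 else 0),
     zero = (\<lambda>_. 0),
     add = (\<lambda>f g w. f w + g w)\<rparr>"

definition arrow_ideal :: "('v, 'e) pre_digraph \<Rightarrow> (('v, 'e) qpath \<Rightarrow> 'k::field) set" where
  "arrow_ideal Q = Idl\<^bsub>path_algebra Q\<^esub> ((\<lambda>a. path_elem (tail Q a, [a])) ` arcs Q)"

primrec ideal_pow :: "('r, 'b) ring_scheme \<Rightarrow> 'r set \<Rightarrow> nat \<Rightarrow> 'r set" where
  "ideal_pow R J 0 = carrier R"
| "ideal_pow R J (Suc n) = ideal_prod R (ideal_pow R J n) J"

definition admissible_ideal ::
    "('v, 'e) pre_digraph \<Rightarrow> (('v, 'e) qpath \<Rightarrow> 'k::field) set \<Rightarrow> bool" where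
  "admissible_ideal Q I \<longleftrightarrow> ideal I (path_algebra Q) \<and>
     (\<exists>n\<ge>2. ideal_pow (path_algebra Q) (arrow_ideal Q) n \<subseteq> I \<and>
            I \<subseteq> ideal_pow (path_algebra Q) (arrow_ideal Q) 2)"

definition gentle ::
    "('v, 'e) pre_digraph \<Rightarrow> (('v, 'e) qpath \<Rightarrow> 'k::field) set \<Rightarrow> bool" where
  "gentle Q I \<longleftrightarrow>
     fin_digraph Q \<and> admissible_ideal Q I \<and>
     (\<exists>W \<subseteq> {w \<in> qpaths Q. length (snd w) = 2}. I = Idl\<^bsub>path_algebra Q\<^esub> (path_elem ` W)) \<and>
     (\<forall>v\<in>verts Q. card {a \<in> arcs Q. tail Q a = v} \<le> 2 \<and> card {a \<in> arcs Q. head Q a = v} \<le> 2) \<and>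
     (\<forall>b\<in>arcs Q.
        card {a \<in> arcs Q. head Q a = tail Q b \<and> path_elem (tail Q a, [a, b]) \<notin> I} \<le> 1 \<and>
        card {a \<in> arcs Q. head Q a = tail Q b \<and> path_elem (tail Q a, [a, b]) \<in> I} \<le> 1 \<and>
        card {a \<in> arcs Q. tail Q a = head Q b \<and> path_elem (tail Q b, [b, a]) \<notin> I} \<le> 1 \<and>
        card {a \<in> arcs Q. tail Q a = head Q b \<and> path_elem (tail Q b, [b, a]) \<in> I} \<le> 1)"

abbreviation bound_quiver_algebra ::
    "('v, 'e) pre_digraph \<Rightarrow> (('v, 'e) qpath \<Rightarrow> 'k::field) set \<Rightarrow> (('v, 'e) qpath \<Rightarrow> 'k) set ring" where
  "bound_quiver_algebra Q I \<equiv> path_algebra Q Quot I"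


section \<open>Right modules and string modules\<close>

text \<open>
  The library's \<open>module\<close> is a left module over a commutative ring. We keep its record type for right
  modules over an arbitrary ring; there \<open>r \<odot>\<^bsub>M\<^esub> m\<close> stands for \<open>m r\<close>, and the inherited fields
  \<open>mult\<close> and \<open>one\<close> are irrelevant.
\<close>

definition right_module :: "('r, 'b) ring_scheme \<Rightarrow> ('r, 'm) module \<Rightarrow> bool" where
  "right_module R M \<longleftrightarrow> ring R \<and> abelian_group M \<and>
     (\<forall>r\<in>carrier R. \<forall>m\<in>carrier M. r \<odot>\<^bsub>M\<^esub> m \<in> carrier M) \<and>
     (\<forall>r\<in>carrier R. \<forall>m\<in>carrier M. \<forall>n\<in>carrier M.
        r \<odot>\<^bsub>M\<^esub> (m \<oplus>\<^bsub>M\<^esub> n) = r \<odot>\<^bsub>M\<^esub> m \<oplus>\<^bsub>M\<^esub> r \<odot>\<^bsub>M\<^esub> n) \<and>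
     (\<forall>r\<in>carrier R. \<forall>s\<in>carrier R. \<forall>m\<in>carrier M.
        (r \<oplus>\<^bsub>R\<^esub> s) \<odot>\<^bsub>M\<^esub> m = r \<odot>\<^bsub>M\<^esub> m \<oplus>\<^bsub>M\<^esub> s \<odot>\<^bsub>M\<^esub> m) \<and>
     (\<forall>r\<in>carrier R. \<forall>s\<in>carrier R. \<forall>m\<in>carrier M.
        (r \<otimes>\<^bsub>R\<^esub> s) \<odot>\<^bsub>M\<^esub> m = s \<odot>\<^bsub>M\<^esub> (r \<odot>\<^bsub>M\<^esub> m)) \<and>
     (\<forall>m\<in>carrier M. \<one>\<^bsub>R\<^esub> \<odot>\<^bsub>M\<^esub> m = m)"

definition finitely_generated :: "('r, 'b) ring_scheme \<Rightarrow> ('r, 'm) module \<Rightarrow> bool" where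
  "finitely_generated R M \<longleftrightarrow> (\<exists>G. finite G \<and> G \<subseteq> carrier M \<and>
     (\<forall>N. G \<subseteq> N \<and> subgroup N (add_monoid M) \<and>
          (\<forall>r\<in>carrier R. \<forall>m\<in>N. r \<odot>\<^bsub>M\<^esub> m \<in> N) \<longrightarrow> N = carrier M))"

definition fg_right_module :: "('r, 'b) ring_scheme \<Rightarrow> ('r, 'm) module \<Rightarrow> bool" where
  "fg_right_module R M \<longleftrightarrow> right_module R M \<and> finitely_generated R M"

definition right_module_hom ::
    "('r, 'b) ring_scheme \<Rightarrow> ('r, 'm) module \<Rightarrow> ('r, 'n) module \<Rightarrow> ('m \<Rightarrow> 'n) set" where
  "right_module_hom R M N = {f.
     (\<forall>m\<in>carrier M. f m \<in> carrier N) \<and>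
     (\<forall>m\<in>carrier M. \<forall>n\<in>carrier M. f (m \<oplus>\<^bsub>M\<^esub> n) = f m \<oplus>\<^bsub>N\<^esub> f n) \<and>
     (\<forall>r\<in>carrier R. \<forall>m\<in>carrier M. f (r \<odot>\<^bsub>M\<^esub> m) = r \<odot>\<^bsub>N\<^esub> f m)}"

text \<open>There is an exact sequence \<open>0 \<rightarrow> L \<rightarrow> M \<rightarrow> N \<rightarrow> 0\<close> of finitely generated right modules.\<close>

definition short_exact ::
    "('r, 'b) ring_scheme \<Rightarrow> ('r, 'l) module \<Rightarrow> ('r, 'm) module \<Rightarrow> ('r, 'n) module \<Rightarrow> bool" where
  "short_exact R L M N \<longleftrightarrow>
     fg_right_module R L \<and> fg_right_module R M \<and> fg_right_module R N \<and>
     (\<exists>f\<in>right_module_hom R L M. \<exists>g\<in>right_module_hom R M N.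
        inj_on f (carrier L) \<and>
        f ` carrier L = {m \<in> carrier M. g m = \<zero>\<^bsub>N\<^esub>} \<and>
        g ` carrier M = carrier N)"

definition module_sum ::
    "('r, 'm) module \<Rightarrow> ('r, 'n) module \<Rightarrow> ('r, 'm \<times> 'n) module" where
  "module_sum M N = \<lparr>
     carrier = carrier M \<times> carrier N,
     mult = undefined, one = undefined,
     zero = (\<zero>\<^bsub>M\<^esub>, \<zero>\<^bsub>N\<^esub>),
     add = (\<lambda>(m, n) (m', n'). (m \<oplus>\<^bsub>M\<^esub> m', n \<oplus>\<^bsub>N\<^esub> n')),
     smult = (\<lambda>r (m, n). (r \<odot>\<^bsub>M\<^esub> m, r \<odot>\<^bsub>N\<^esub> n))\<rparr>"

text \<open>
  A walk is given by the list \<open>xs\<close> of its vertices and the list \<open>ls\<close> of its letters, \<open>ls ! j\<close> joining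
  \<open>xs ! j\<close> and \<open>xs ! (j + 1)\<close>: \<open>(a, True)\<close> is the arrow \<open>a\<close> from \<open>xs ! j\<close> to \<open>xs ! (j + 1)\<close> and
  \<open>(a, False)\<close> the formal inverse of the arrow \<open>a\<close> from \<open>xs ! (j + 1)\<close> to \<open>xs ! j\<close>. A vector is the
  function of its coordinates with respect to the basis indexed by the positions.
\<close>

definition string_idem :: "'v list \<Rightarrow> 'v \<Rightarrow> (nat \<Rightarrow> 'k::field) \<Rightarrow> nat \<Rightarrow> 'k" where
  "string_idem xs u m = (\<lambda>j. if j < length xs \<and> xs ! j = u then m j else 0)"

definition string_arrow ::
    "'v list \<Rightarrow> ('e \<times> bool) list \<Rightarrow> 'e \<Rightarrow> (nat \<Rightarrow> 'k::field) \<Rightarrow> nat \<Rightarrow> 'k" where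
  "string_arrow xs ls a m = (\<lambda>j.
     (if 0 < j \<and> j < length xs \<and> ls ! (j - 1) = (a, True) then m (j - 1) else 0) +
     (if j + 1 < length xs \<and> ls ! j = (a, False) then m (j + 1) else 0))"

definition string_path ::
    "'v list \<Rightarrow> ('e \<times> bool) list \<Rightarrow> ('v, 'e) qpath \<Rightarrow> (nat \<Rightarrow> 'k::field) \<Rightarrow> nat \<Rightarrow> 'k" where
  "string_path xs ls w m = fold (string_arrow xs ls) (snd w) (string_idem xs (fst w) m)"

text \<open>A residue class acts through any of its representatives.\<close>

definition string_module ::
    "'v list \<Rightarrow> ('e \<times> bool) list \<Rightarrow> ((('v, 'e) qpath \<Rightarrow> 'k::field) set, nat \<Rightarrow> 'k) module" where
  "string_module xs ls = \<lparr>
     carrier = {m. \<forall>j\<ge>length xs. m j = 0},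
     mult = undefined, one = undefined,
     zero = (\<lambda>_. 0),
     add = (\<lambda>m n j. m j + n j),
     smult = (\<lambda>X m. let f = (SOME f. f \<in> X) in
                (\<lambda>j. \<Sum>w | f w \<noteq> 0. f w * string_path xs ls w m j))\<rparr>"


section \<open>Oriented surfaces with boundary\<close>

definition surface_chart :: "'a topology \<Rightarrow> 'a set \<Rightarrow> ('a \<Rightarrow> complex) \<Rightarrow> bool" where
  "surface_chart X U \<psi> \<longleftrightarrow> openin X U \<and>
     openin (top_of_set {z. 0 \<le> Im z}) (\<psi> ` U) \<and>
     homeomorphic_map (subtopology X U) (top_of_set (\<psi> ` U)) \<psi>"

definition surface_boundary :: "'a topology \<Rightarrow> 'a set" where
  "surface_boundary X = {x. \<exists>U \<psi>. surface_chart X U \<psi> \<and> x \<in> U \<and> Im (\<psi> x) = 0}"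

text \<open>For an injective continuous map on an open subset of the plane, the image of a small
  counterclockwise circle winds once around the image of its centre, counterclockwise precisely
  if the map preserves the orientation.\<close>

definition orientation_preserving :: "complex set \<Rightarrow> (complex \<Rightarrow> complex) \<Rightarrow> bool" where
  "orientation_preserving W f \<longleftrightarrow>
     (\<forall>z\<in>W. \<exists>e>0. cball z e \<subseteq> W \<and> winding_number (f \<circ> circlepath z e) (f z) = 1)"

definition oriented_surface :: "'a topology \<Rightarrow> ('a set \<times> ('a \<Rightarrow> complex)) set \<Rightarrow> bool" where
  "oriented_surface X \<A> \<longleftrightarrow>
     Hausdorff_space X \<and> second_countable X \<and>
     (\<forall>(U, \<psi>)\<in>\<A>. surface_chart X U \<psi>) \<and> \<Union>(fst ` \<A>) = topspace X \<and>
     (\<forall>(U, \<psi>)\<in>\<A>. \<forall>(U', \<psi>')\<in>\<A>.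
        orientation_preserving (\<psi> ` (U \<inter> U') \<inter> {z. 0 < Im z}) (\<psi>' \<circ> inv_into U \<psi>))"


section \<open>Marked ribbon surfaces\<close>

text \<open>
  A polygon of a decomposition is given by a parametrisation \<open>chart P\<close> whose domain is the closed
  unit disc, or, if \<open>hole P\<close>, the closed annulus between the radii \<open>1/2\<close> and \<open>1\<close>. The unit circle is
  divided counterclockwise into sides, the side \<open>k\<close> running from the vertex \<open>k\<close> to the vertex
  \<open>k + 1\<close>. The sides \<open>0, \<dots>, gsides P - 1\<close> are those in \<open>\<Gamma>\<close>. The one side not in \<open>\<Gamma>\<close> is the side
  \<open>gsides P\<close> in the case of a disc and the inner circle in the case of an annulus.
\<close>

record 'a polygon =
  gsides :: nat
  hole :: bool
  chart :: "complex \<Rightarrow> 'a"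

definition outer_sides :: "'a polygon \<Rightarrow> nat" where
  "outer_sides P = (if hole P then gsides P else gsides P + 1)"

definition poly_dom :: "'a polygon \<Rightarrow> complex set" where
  "poly_dom P = (if hole P then {z. 1/2 \<le> cmod z \<and> cmod z \<le> 1} else cball 0 1)"

definition poly_angle :: "'a polygon \<Rightarrow> real \<Rightarrow> real" where
  "poly_angle P s = 2 * pi * s / outer_sides P"

definition vertex :: "'a polygon \<Rightarrow> nat \<Rightarrow> complex" where
  "vertex P k = cis (poly_angle P k)"

definition side :: "'a polygon \<Rightarrow> nat \<Rightarrow> complex set" where
  "side P k = (\<lambda>s. cis (poly_angle P s)) ` {real k..real k + 1}"

definition open_side :: "'a polygon \<Rightarrow> nat \<Rightarrow> complex set" where
  "open_side P k = (\<lambda>s. cis (poly_angle P s)) ` {real k<..<real k + 1}"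

text \<open>The polygon without its sides in \<open>\<Gamma>\<close>, in the parameter domain and in the surface.\<close>

definition face_dom :: "'a polygon \<Rightarrow> complex set" where
  "face_dom P = poly_dom P - (\<Union>k<gsides P. side P k)"

definition face :: "'a polygon \<Rightarrow> 'a set" where
  "face P = chart P ` face_dom P"

text \<open>
  A marked ribbon surface \<open>(S, M, \<Gamma>)\<close>. The orientation of \<open>S\<close> is given by an atlas. The last two
  fields are determined by the triple up to irrelevant choices: parametrisations of the
  elementary polygons into which \<open>\<Gamma>\<close> divides \<open>S\<close>, and the set \<open>E\<close> of extra points.
\<close>

record 'a ribbon_surface =
  surf :: "'a topology"
  atlas :: "('a set \<times> ('a \<Rightarrow> complex)) set"
  marked :: "'a set"
  curves :: "(real \<Rightarrow> 'a) set"
  polys :: "'a polygon set"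
  extra :: "'a set"

definition bdry :: "'a ribbon_surface \<Rightarrow> 'a set" where
  "bdry S = surface_boundary (surf S)"

definition arcs_union :: "'a ribbon_surface \<Rightarrow> 'a set" where
  "arcs_union S = (\<Union>\<gamma>\<in>curves S. \<gamma> ` {0..1})"

definition elementary_polygon :: "'a ribbon_surface \<Rightarrow> 'a polygon \<Rightarrow> bool" where
  "elementary_polygon S P \<longleftrightarrow>
     (hole P \<longrightarrow> 0 < gsides P) \<and>
     continuous_map (top_of_set (poly_dom P)) (surf S) (chart P) \<and>
     homeomorphic_map (top_of_set (face_dom P)) (subtopology (surf S) (face P)) (chart P) \<and>
     (\<forall>(U, \<psi>)\<in>atlas S. orientation_preserving
        {z \<in> interior (poly_dom P). chart P z \<in> U} (\<psi> \<circ> chart P)) \<and>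
     (\<forall>k<outer_sides P. chart P (vertex P k) \<in> marked S) \<and>
     (\<forall>k<gsides P. \<exists>\<gamma>\<in>curves S. bij_betw (chart P) (open_side P k) (\<gamma> ` {0<..<1})) \<and>
     (if hole P
      then chart P ` sphere 0 (1/2) \<in> connected_components_of (subtopology (surf S) (bdry S)) \<and>
           chart P ` sphere 0 (1/2) \<inter> marked S = {}
      else chart P ` side P (gsides P) \<subseteq> bdry S \<and>
           chart P ` open_side P (gsides P) \<inter> marked S = {})"

definition digon :: "'a polygon \<Rightarrow> bool" where
  "digon P \<longleftrightarrow> \<not> hole P \<and> gsides P = 1"

definition marked_ribbon_surface :: "'a ribbon_surface \<Rightarrow> bool" where
  "marked_ribbon_surface S \<longleftrightarrow>
     oriented_surface (surf S) (atlas S) \<and> connected_space (surf S) \<and> bdry S \<noteq> {} \<and>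
     finite (marked S) \<and> marked S \<subseteq> bdry S \<and>
     (\<forall>\<gamma>\<in>curves S. pathin (surf S) \<gamma> \<and> \<gamma> 0 \<in> marked S \<and> \<gamma> 1 \<in> marked S \<and>
        inj_on \<gamma> {0<..<1} \<and> \<gamma> ` {0<..<1} \<subseteq> topspace (surf S) - bdry S) \<and>
     (\<forall>\<gamma>\<in>curves S. \<forall>\<delta>\<in>curves S. \<gamma> \<noteq> \<delta> \<longrightarrow> \<gamma> ` {0<..<1} \<inter> \<delta> ` {0<..<1} = {}) \<and>
     (\<forall>P\<in>polys S. elementary_polygon S P) \<and>
     bij_betw face (polys S)
       (connected_components_of (subtopology (surf S) (topspace (surf S) - arcs_union S))) \<and>
     extra S \<subseteq> (\<Union>P\<in>{P \<in> polys S. digon P}. chart P ` open_side P 1) \<and>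
     (\<forall>P\<in>polys S. digon P \<longrightarrow> (\<exists>!x. x \<in> extra S \<and> x \<in> chart P ` open_side P 1))"


section \<open>The algebra of a marked ribbon surface\<close>

text \<open>The pair \<open>(P, k)\<close> stands for the corner of the polygon \<open>P\<close> at the vertex \<open>k + 1\<close>, provided that
  both sides there, \<open>k\<close> and \<open>k + 1\<close>, are in \<open>\<Gamma>\<close>. Since the sides are numbered counterclockwise around
  \<open>P\<close>, it is the side \<open>k\<close> that follows the side \<open>k + 1\<close> counterclockwise around the vertex.\<close>

definition is_corner :: "'a polygon \<Rightarrow> nat \<Rightarrow> bool" where
  "is_corner P k \<longleftrightarrow> k < gsides P \<and> (hole P \<or> k + 1 < gsides P)"

definition side_arc :: "'a ribbon_surface \<Rightarrow> 'a polygon \<Rightarrow> nat \<Rightarrow> real \<Rightarrow> 'a" where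
  "side_arc S P k = (THE \<gamma>. \<gamma> \<in> curves S \<and>
     chart P ` open_side P (k mod outer_sides P) = \<gamma> ` {0<..<1})"

definition ribbon_quiver :: "'a ribbon_surface \<Rightarrow> (real \<Rightarrow> 'a, 'a polygon \<times> nat) pre_digraph" where
  "ribbon_quiver S = \<lparr>
     verts = curves S,
     arcs = {(P, k). P \<in> polys S \<and> is_corner P k},
     tail = (\<lambda>(P, k). side_arc S P (k + 1)),
     head = (\<lambda>(P, k). side_arc S P k)\<rparr>"

text \<open>The compositions \<open>u \<rightarrow> v \<rightarrow> w\<close> of two arrows arising from the same elementary polygon, where
  \<open>u\<close>, \<open>v\<close>, \<open>w\<close> are three consecutive sides (the two arrows meet at the same side \<open>v\<close>; recall that
  an arc may occur as two different sides of one polygon).\<close>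

definition ribbon_relations ::
    "'a ribbon_surface \<Rightarrow> (real \<Rightarrow> 'a, 'a polygon \<times> nat) qpath set" where
  "ribbon_relations S =
     {(side_arc S P (k + 2), [(P, (k + 1) mod outer_sides P), (P, k)]) | P k.
        P \<in> polys S \<and> is_corner P k \<and> is_corner P ((k + 1) mod outer_sides P)}"

definition ribbon_ideal ::
    "'a ribbon_surface \<Rightarrow> ((real \<Rightarrow> 'a, 'a polygon \<times> nat) qpath \<Rightarrow> 'k::field) set" where
  "ribbon_ideal S = Idl\<^bsub>path_algebra (ribbon_quiver S)\<^esub> (path_elem ` ribbon_relations S)"

text \<open>\<open>S\<close> is the marked ribbon surface of \<open>A = kQ/I\<close>: the maps \<open>nv\<close> on vertices and \<open>na\<close> on arrows
  form an isomorphism from \<open>Q\<close> onto the quiver of \<open>S\<close>, and the ideals correspond to each other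
  under the induced isomorphism of path algebras.\<close>

definition ribbon_surface_of ::
    "('v, 'e) pre_digraph \<Rightarrow> (('v, 'e) qpath \<Rightarrow> 'k::field) set \<Rightarrow>
     ('v \<Rightarrow> real \<Rightarrow> 'a) \<Rightarrow> ('e \<Rightarrow> 'a polygon \<times> nat) \<Rightarrow> 'a ribbon_surface \<Rightarrow> bool" where
  "ribbon_surface_of Q I nv na S \<longleftrightarrow>
     marked_ribbon_surface S \<and>
     bij_betw nv (verts Q) (verts (ribbon_quiver S)) \<and>
     bij_betw na (arcs Q) (arcs (ribbon_quiver S)) \<and>
     (\<forall>a\<in>arcs Q. tail (ribbon_quiver S) (na a) = nv (tail Q a) \<and>
                 head (ribbon_quiver S) (na a) = nv (head Q a)) \<and>
     I = (\<lambda>f (u, es). if (u, es) \<in> qpaths Q then f (nv u, map na es) else 0) ` ribbon_ideal S"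


section \<open>Curves and their crossings\<close>

text \<open>A curve \<open>(0,1) \<rightarrow> S - \<partial>S\<close> having endpoints is extended to \<open>[0,1]\<close> by these endpoints.\<close>

definition curve_in :: "'a ribbon_surface \<Rightarrow> (real \<Rightarrow> 'a) \<Rightarrow> bool" where
  "curve_in S c \<longleftrightarrow> pathin (surf S) c \<and> c ` {0<..<1} \<subseteq> topspace (surf S) - bdry S \<and>
     c 0 \<in> marked S \<union> extra S \<and> c 1 \<in> marked S \<union> extra S"

definition homotopic_curves :: "'a ribbon_surface \<Rightarrow> (real \<Rightarrow> 'a) \<Rightarrow> (real \<Rightarrow> 'a) \<Rightarrow> bool" where
  "homotopic_curves S c d \<longleftrightarrow>
     homotopic_with (\<lambda>h. curve_in S h \<and> h 0 = c 0 \<and> h 1 = c 1) (top_of_set {0..1}) (surf S) c d"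

definition crossing_times :: "'a ribbon_surface \<Rightarrow> (real \<Rightarrow> 'a) \<Rightarrow> real set" where
  "crossing_times S c = {t \<in> {0<..<1}. c t \<in> arcs_union S}"

text \<open>\<open>c\<close> is cut by \<open>\<Gamma>\<close> into \<open>r = segments S c\<close> segments \<open>c\<^sub>1, \<dots>, c\<^sub>r\<close>, the segment \<open>c\<^sub>j\<close> lasting from
  \<open>cut_time S c (j - 1)\<close> to \<open>cut_time S c j\<close>, and \<open>\<gamma>\<^sub>1, \<dots>, \<gamma>\<^bsub>r-1\<^esub>\<close> are the arcs that it crosses.\<close>

definition segments :: "'a ribbon_surface \<Rightarrow> (real \<Rightarrow> 'a) \<Rightarrow> nat" where
  "segments S c = card (crossing_times S c) + 1"

definition cut_time :: "'a ribbon_surface \<Rightarrow> (real \<Rightarrow> 'a) \<Rightarrow> nat \<Rightarrow> real" where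
  "cut_time S c j = (0 # sorted_list_of_set (crossing_times S c) @ [1]) ! j"

definition segment :: "'a ribbon_surface \<Rightarrow> (real \<Rightarrow> 'a) \<Rightarrow> nat \<Rightarrow> real \<Rightarrow> 'a" where
  "segment S c j = (\<lambda>s. c (cut_time S c (j - 1) + (cut_time S c j - cut_time S c (j - 1)) * s))"

definition crossed_arc :: "'a ribbon_surface \<Rightarrow> (real \<Rightarrow> 'a) \<Rightarrow> nat \<Rightarrow> real \<Rightarrow> 'a" where
  "crossed_arc S c j = (THE \<gamma>. \<gamma> \<in> curves S \<and> c (cut_time S c j) \<in> \<gamma> ` {0<..<1})"

text \<open>Every segment lies in one elementary polygon and lifts to its parameter domain.\<close>

definition lifts_to :: "'a polygon \<Rightarrow> (real \<Rightarrow> 'a) \<Rightarrow> (real \<Rightarrow> complex) \<Rightarrow> bool" where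
  "lifts_to P \<sigma> z \<longleftrightarrow> path z \<and> path_image z \<subseteq> poly_dom P \<and> (\<forall>s\<in>{0..1}. chart P (z s) = \<sigma> s)"

text \<open>There are finitely many crossings, and each is a genuine one: \<open>c\<close> does not leave the arc on
  the side from which it arrived.\<close>

definition general_position :: "'a ribbon_surface \<Rightarrow> (real \<Rightarrow> 'a) \<Rightarrow> bool" where
  "general_position S c \<longleftrightarrow> finite (crossing_times S c) \<and>
     (\<forall>j\<in>{1..<segments S c}. \<forall>P\<in>polys S. \<forall>z z'.
        lifts_to P (segment S c j) z \<and> lifts_to P (segment S c (j + 1)) z' \<longrightarrow> z 1 \<noteq> z' 0)"

definition minimal_crossings :: "'a ribbon_surface \<Rightarrow> (real \<Rightarrow> 'a) \<Rightarrow> bool" where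
  "minimal_crossings S c \<longleftrightarrow> general_position S c \<and>
     (\<forall>d. homotopic_curves S c d \<and> general_position S d \<longrightarrow>
        card (crossing_times S c) \<le> card (crossing_times S d))"

text \<open>The part of the boundary circle of \<open>P\<close> from parameter \<open>s\<close> to parameter \<open>t\<close>, where the vertex \<open>k\<close>
  has parameter \<open>k\<close>.\<close>

definition poly_arc :: "'a polygon \<Rightarrow> real \<Rightarrow> real \<Rightarrow> real \<Rightarrow> complex" where
  "poly_arc P s t = part_circlepath 0 1 (poly_angle P s) (poly_angle P t)"

text \<open>The segment \<open>\<sigma>\<close> crosses the corner \<open>(P, k)\<close>: together with the part of the side where it starts
  up to the vertex \<open>k + 1\<close>, and the part of the side where it ends from this vertex on, it bounds a
  triangle in \<open>P\<close>, which does not contain the hole of \<open>P\<close>. The vertex \<open>k + 1\<close> is on the left of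
  \<open>\<sigma>\<close> if \<open>\<sigma>\<close> goes from the side \<open>k + 1\<close> to the side \<open>k\<close>, and on the right if \<open>\<sigma>\<close> goes from the side \<open>k\<close>
  to the side \<open>k + 1\<close>. (The triangle may be singular, as curves need not be simple.)\<close>

definition crosses_corner ::
    "'a ribbon_surface \<Rightarrow> (real \<Rightarrow> 'a) \<Rightarrow> 'a polygon \<Rightarrow> nat \<Rightarrow> bool \<Rightarrow> bool" where
  "crosses_corner S \<sigma> P k left \<longleftrightarrow> P \<in> polys S \<and> is_corner P k \<and>
     (\<exists>z \<alpha> \<beta>. lifts_to P \<sigma> z \<and> real k < \<alpha> \<and> \<alpha> < real k + 1 \<and> real k + 1 < \<beta> \<and> \<beta> < real k + 2 \<and>
        homotopic_paths (poly_dom P) z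
          (if left then poly_arc P \<beta> (real k + 1) +++ poly_arc P (real k + 1) \<alpha>
           else poly_arc P \<alpha> (real k + 1) +++ poly_arc P (real k + 1) \<beta>))"

text \<open>The number of full turns that the segment \<open>\<sigma>\<close> makes around an unmarked boundary component is at
  most one. The real part of the winding number of a path that need not be closed is its total change
  of argument divided by \<open>2\<pi>\<close>.\<close>

definition winding_at_most_one :: "'a ribbon_surface \<Rightarrow> (real \<Rightarrow> 'a) \<Rightarrow> bool" where
  "winding_at_most_one S \<sigma> \<longleftrightarrow> (\<forall>P\<in>polys S. \<forall>z. hole P \<and> lifts_to P \<sigma> z \<longrightarrow>
     \<lfloor>\<bar>Re (winding_number z 0)\<bar>\<rfloor> \<in> {0, 1})"

definition permissible :: "'a ribbon_surface \<Rightarrow> (real \<Rightarrow> 'a) \<Rightarrow> bool" where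
  "permissible S c \<longleftrightarrow> curve_in S c \<and> minimal_crossings S c \<and>
     winding_at_most_one S (segment S c 1) \<and>
     winding_at_most_one S (segment S c (segments S c)) \<and>
     (\<forall>j. 2 \<le> j \<and> j < segments S c \<longrightarrow> (\<exists>P k left. crosses_corner S (segment S c j) P k left))"

text \<open>The corner, and its side, crossed by the segment \<open>c\<^sub>j\<close> between \<open>\<gamma>\<^bsub>j-1\<^esub>\<close> and \<open>\<gamma>\<^sub>j\<close>, and the point
  \<open>p(\<gamma>\<^bsub>j-1\<^esub>, \<gamma>\<^sub>j, c)\<close>.\<close>

definition corner_at ::
    "'a ribbon_surface \<Rightarrow> (real \<Rightarrow> 'a) \<Rightarrow> nat \<Rightarrow> ('a polygon \<times> nat) \<times> bool" where
  "corner_at S c j = (THE x. crosses_corner S (segment S c j) (fst (fst x)) (snd (fst x)) (snd x))"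

definition corner_point :: "'a ribbon_surface \<Rightarrow> (real \<Rightarrow> 'a) \<Rightarrow> nat \<Rightarrow> 'a" where
  "corner_point S c j = (case fst (corner_at S c j) of (P, k) \<Rightarrow> chart P (vertex P (k + 1)))"

abbreviation turns_left :: "'a ribbon_surface \<Rightarrow> (real \<Rightarrow> 'a) \<Rightarrow> nat \<Rightarrow> bool" where
  "turns_left S c j \<equiv> snd (corner_at S c j)"

abbreviation turns_right :: "'a ribbon_surface \<Rightarrow> (real \<Rightarrow> 'a) \<Rightarrow> nat \<Rightarrow> bool" where
  "turns_right S c j \<equiv> \<not> snd (corner_at S c j)"

text \<open>The endpoints of \<open>\<gamma>\<^sub>j\<close> on the left and on the right of \<open>c\<close>. Where \<open>c\<close> leaves a polygon through
  its side \<open>k\<close>, the end \<open>k + 1\<close> of this side is on its left.\<close>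

definition left_endpoint :: "'a ribbon_surface \<Rightarrow> (real \<Rightarrow> 'a) \<Rightarrow> nat \<Rightarrow> 'a \<Rightarrow> bool" where
  "left_endpoint S c j x \<longleftrightarrow> (\<exists>P\<in>polys S. \<exists>k<gsides P. \<exists>z.
     lifts_to P (segment S c j) z \<and> z 1 \<in> open_side P k \<and> x = chart P (vertex P (k + 1)))"

definition right_endpoint :: "'a ribbon_surface \<Rightarrow> (real \<Rightarrow> 'a) \<Rightarrow> nat \<Rightarrow> 'a \<Rightarrow> bool" where
  "right_endpoint S c j x \<longleftrightarrow> (\<exists>P\<in>polys S. \<exists>k<gsides P. \<exists>z.
     lifts_to P (segment S c j) z \<and> z 1 \<in> open_side P k \<and> x = chart P (vertex P k))"

definition curve_module ::
    "('v, 'e) pre_digraph \<Rightarrow> ('v \<Rightarrow> real \<Rightarrow> 'a) \<Rightarrow> ('e \<Rightarrow> 'a polygon \<times> nat) \<Rightarrow>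
     'a ribbon_surface \<Rightarrow> (real \<Rightarrow> 'a) \<Rightarrow> ((('v, 'e) qpath \<Rightarrow> 'k::field) set, nat \<Rightarrow> 'k) module" where
  "curve_module Q nv na S c = string_module
     (map (\<lambda>j. inv_into (verts Q) nv (crossed_arc S c j)) [1..<segments S c])
     (map (\<lambda>j. (inv_into (arcs Q) na (fst (corner_at S c j)), turns_left S c j))
        [2..<segments S c])"


section \<open>Curves running along a given curve\<close>

definition runs_along :: "(real \<Rightarrow> 'a) \<Rightarrow> (real \<Rightarrow> 'a) \<Rightarrow> bool" where
  "runs_along \<sigma>' \<sigma> \<longleftrightarrow> (\<exists>h. continuous_on {0..1} h \<and> strict_mono_on {0..1} h \<and>
     h 0 = 0 \<and> h 1 = (1::real) \<and> (\<forall>s\<in>{0..1}. \<sigma>' s = \<sigma> (h s)))"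

text \<open>\<open>d\<close> crosses exactly \<open>\<gamma>\<^sub>a, \<dots>, \<gamma>\<^sub>b\<close>, running along \<open>c\<^bsub>a+1\<^esub>\<cdots>c\<^sub>b\<close> between the first and the last crossing.\<close>

definition crosses_exactly ::
    "'a ribbon_surface \<Rightarrow> (real \<Rightarrow> 'a) \<Rightarrow> nat \<Rightarrow> nat \<Rightarrow> (real \<Rightarrow> 'a) \<Rightarrow> bool" where
  "crosses_exactly S c a b d \<longleftrightarrow>
     a \<le> b \<and> segments S d = b - a + 2 \<and>
     (\<forall>j\<in>{a..b}. crossed_arc S d (j - a + 1) = crossed_arc S c j) \<and>
     (\<forall>j\<in>{a+1..b}. runs_along (segment S d (j - a + 1)) (segment S c j))"

definition starts_along :: "'a ribbon_surface \<Rightarrow> (real \<Rightarrow> 'a) \<Rightarrow> (real \<Rightarrow> 'a) \<Rightarrow> bool" where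
  "starts_along S c d \<longleftrightarrow> runs_along (segment S d 1) (segment S c 1)"

definition ends_along :: "'a ribbon_surface \<Rightarrow> (real \<Rightarrow> 'a) \<Rightarrow> (real \<Rightarrow> 'a) \<Rightarrow> bool" where
  "ends_along S c d \<longleftrightarrow> runs_along (segment S d (segments S d)) (segment S c (segments S c))"

text \<open>\<open>d\<close> starts at the endpoint of \<open>\<gamma>\<^bsub>j-1\<^esub>\<close> other than \<open>p(\<gamma>\<^bsub>j-1\<^esub>, \<gamma>\<^sub>j, c)\<close> and reaches \<open>\<gamma>\<^sub>j\<close> within the
  elementary polygon containing \<open>c\<^sub>j\<close>. If \<open>c\<^sub>j\<close> goes from the side \<open>k + 1\<close> to the side \<open>k\<close> then the two
  ends of \<open>\<gamma>\<^bsub>j-1\<^esub>\<close> are the vertices \<open>k + 1\<close> and \<open>k + 2\<close>, the first being \<open>p(\<gamma>\<^bsub>j-1\<^esub>, \<gamma>\<^sub>j, c)\<close>; in the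
  opposite direction they are \<open>k\<close> and \<open>k + 1\<close>. The two ends of an arc are distinguished even if
  they are the same point of \<open>S\<close>.\<close>

definition starts_opposite ::
    "'a ribbon_surface \<Rightarrow> (real \<Rightarrow> 'a) \<Rightarrow> nat \<Rightarrow> (real \<Rightarrow> 'a) \<Rightarrow> bool" where
  "starts_opposite S c j d \<longleftrightarrow> (case corner_at S c j of ((P, k), left) \<Rightarrow>
     \<exists>z. lifts_to P (segment S d 1) z \<and>
         z 0 = vertex P (if left then k + 2 else k) \<and>
         z 1 \<in> open_side P (if left then k else k + 1))"

text \<open>\<open>d\<close> ends, within the elementary polygon containing \<open>c\<^sub>j\<close>, which it enters through \<open>\<gamma>\<^bsub>j-1\<^esub>\<close>, at the
  endpoint of \<open>\<gamma>\<^sub>j\<close> other than \<open>p(\<gamma>\<^bsub>j-1\<^esub>, \<gamma>\<^sub>j, c)\<close>.\<close>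

definition ends_opposite ::
    "'a ribbon_surface \<Rightarrow> (real \<Rightarrow> 'a) \<Rightarrow> nat \<Rightarrow> (real \<Rightarrow> 'a) \<Rightarrow> bool" where
  "ends_opposite S c j d \<longleftrightarrow> (case corner_at S c j of ((P, k), left) \<Rightarrow>
     \<exists>z. lifts_to P (segment S d (segments S d)) z \<and>
         z 0 \<in> open_side P (if left then k + 1 else k) \<and>
         z 1 = vertex P (if left then k else k + 2))"

end

theory Submission
  imports Defs
begin

text \<open>
  The exact sequences are statements about strings: an interval of positions of a walk spans a
  submodule of the string module if the letters next to it point towards it, and is a quotient
  module if they point away from it. The letter at a corner points forward exactly if the corner is
  on the left of the curve, so the hypotheses on left and right in the three cases say that the
  crossings of the smaller curves form such intervals.

  What makes \<open>M(c)\<close> a module at all is geometric. A segment lies in a single polygon and lifts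
  uniquely to its parameter domain, so the corner that it crosses is determined and its two sides
  are the arcs at the ends of the segment; in an annulus, left and right are told apart by the
  winding number around the hole. A relation is a composition of two corners meeting at the same
  side of one polygon, and \<open>c\<close> would have to turn back at that side to read it.
\<close>

section \<open>The path algebra\<close>

text \<open>A residue class acts on a string module through an arbitrarily chosen representative, so
  no module axiom can be checked before the ideal is known to act by zero. This follows from an
  upper bound for the ideal: every path in the support of one of its elements contains two
  consecutive arrows forming a relation. The elements with such supports form a two-sided ideal, so
  the bound passes from the generators to the whole ideal, and then along the identification of
  \<open>Q\<close> with the quiver of \<open>S\<close>.

  Relations are compared through sides of polygons rather than through arcs: if an arc is two sides
  of one polygon, two arrows composing at this arc form a relation only if they meet at the same
  side.

  A smaller curve agrees with \<open>c\<close> between its own crossings only up to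
  reparametrisation. Corners are invariant under it, so its module is equal, not merely isomorphic,
  to the string module of a contiguous piece of the walk of \<open>c\<close>. The maps in the exact
  sequences are extension by zero and restriction of coordinates.\<close>

definition path_end :: "('v, 'e) pre_digraph \<Rightarrow> 'v \<Rightarrow> 'e list \<Rightarrow> 'v" where
  "path_end Q u es = (if es = [] then u else head Q (last es))"

text \<open>Holds for every list of arrows, walk or not: the library's vertex sequence of a
  non-empty list consists of the tails followed by the head of the last arrow.\<close>

lemma awlast_eq_path_end: "pre_digraph.awlast Q u es = path_end Q u es"
  by (simp add: pre_digraph.awalk_verts_conv path_end_def)

lemma path_end_append: "path_end Q (path_end Q u es) fs = path_end Q u (es @ fs)"
  by (simp add: path_end_def)

lemma qpaths_append:
  assumes "wf_digraph Q"
  shows "(u, es @ fs) \<in> qpaths Q \<longleftrightarrow> (u, es) \<in> qpaths Q \<and> (path_end Q u es, fs) \<in> qpaths Q"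
proof -
  interpret wf_digraph Q by fact
  show ?thesis
    unfolding qpaths_def awlast_eq_path_end[symmetric]
    by (auto simp: awalk_append_iff) 
qed

lemma qpaths_Nil: "(u, []) \<in> qpaths Q \<longleftrightarrow> u \<in> verts Q"
  by (auto simp: qpaths_def pre_digraph.awalk_def intro!: exI[of _ u] pre_digraph.cas.simps(1)[THEN iffD2])

lemma path_end_in_verts:
  assumes "wf_digraph Q" "(u, es) \<in> qpaths Q"
  shows "path_end Q u es \<in> verts Q"
  using qpaths_append[OF assms(1), of u es "[]"] assms(2) by (simp add: qpaths_Nil)

lemma path_algebra_carrier:
  "f \<in> carrier (path_algebra Q) \<longleftrightarrow> finite {w. f w \<noteq> 0} \<and> (\<forall>w. f w \<noteq> 0 \<longrightarrow> w \<in> qpaths Q)"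
  by (auto simp: path_algebra_def)

lemma path_algebra_mult:
  "(f \<otimes>\<^bsub>path_algebra Q\<^esub> g) (u, es) =
     (\<Sum>i\<le>length es. f (u, take i es) * g (path_end Q u (take i es), drop i es))"
  by (simp add: path_algebra_def awlast_eq_path_end)

lemma path_algebra_one:
  "\<one>\<^bsub>path_algebra Q\<^esub> (u, es) = (if u \<in> verts Q \<and> es = [] then 1 else 0)"
  by (simp add: path_algebra_def)

lemma path_algebra_zero: "\<zero>\<^bsub>path_algebra Q\<^esub> = (\<lambda>_. 0)"
  by (simp add: path_algebra_def)

lemma path_algebra_add: "(f \<oplus>\<^bsub>path_algebra Q\<^esub> g) = (\<lambda>w. f w + g w)"
  by (simp add: path_algebra_def)

text \<open>Closure under products and the ideal property of supports both rest on this passage from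
  a coefficient to a factorisation.\<close>

lemma path_algebra_mult_nonzero:
  assumes "(f \<otimes>\<^bsub>path_algebra Q\<^esub> g) (u, w) \<noteq> 0"
  obtains es fs where "w = es @ fs" "f (u, es) \<noteq> 0" "g (path_end Q u es, fs) \<noteq> 0"
proof -
  obtain i where "f (u, take i w) * g (path_end Q u (take i w), drop i w) \<noteq> 0"
    using assms unfolding path_algebra_mult by (meson sum.not_neutral_contains_not_neutral)
  then show thesis
    by (intro that[of "take i w" "drop i w"]) auto
qed

text \<open>The support of a product lies in the finite set of concatenations of support elements.
  The concatenations that occur are paths because the second factor starts where the first one
  ends.\<close>

lemma path_algebra_mult_closed:
  fixes f :: "('v, 'e) qpath \<Rightarrow> 'k::field"
  assumes Q: "wf_digraph Q"
    and f: "f \<in> carrier (path_algebra Q)" and g: "g \<in> carrier (path_algebra Q)"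
  shows "f \<otimes>\<^bsub>path_algebra Q\<^esub> g \<in> carrier (path_algebra Q)"
proof -
  let ?h = "f \<otimes>\<^bsub>path_algebra Q\<^esub> g"
  let ?cat = "\<lambda>(v, w). (fst v, snd v @ snd w)"
  have "w \<in> ?cat ` ({w. f w \<noteq> 0} \<times> {w. g w \<noteq> 0}) \<and> w \<in> qpaths Q" if nz: "?h w \<noteq> 0" for w
  proof -
    obtain u es fs where w: "w = (u, es @ fs)"
      and "f (u, es) \<noteq> 0" "g (path_end Q u es, fs) \<noteq> 0"
      using path_algebra_mult_nonzero nz by (metis surj_pair)
    moreover from this have "(u, es @ fs) \<in> qpaths Q"
      using f g unfolding qpaths_append[OF Q] path_algebra_carrier by blast
    ultimately show ?thesis
      by (auto intro!: rev_image_eqI[of "((u, es), (path_end Q u es, fs))"])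
  qed
  moreover have "finite (?cat ` ({w. f w \<noteq> 0} \<times> {w. g w \<noteq> 0}))"
    using f g by (simp add: path_algebra_carrier)
  ultimately show ?thesis
    unfolding path_algebra_carrier by (blast intro: finite_subset)
qed

text \<open>Both sides sum over the cuts of a path into three pieces. \<open>F j k\<close> is the
  term whose first two pieces have lengths \<open>j\<close> and \<open>k\<close>; the left side
  groups these terms by \<open>j + k\<close>, the right side by \<open>j\<close>.\<close>

lemma path_algebra_mult_assoc:
  "f \<otimes>\<^bsub>path_algebra Q\<^esub> g \<otimes>\<^bsub>path_algebra Q\<^esub> h = f \<otimes>\<^bsub>path_algebra Q\<^esub> (g \<otimes>\<^bsub>path_algebra Q\<^esub> h)"
proof
  fix w :: "'a \<times> 'b list"
  obtain u es where w: "w = (u, es)" by (cases w)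
  define e where "e i = path_end Q u (take i es)" for i
  define F where "F j k = f (u, take j es) * g (e j, take k (drop j es)) *
     h (e (j + k), drop (j + k) es)" for j k
  have "(f \<otimes>\<^bsub>path_algebra Q\<^esub> g \<otimes>\<^bsub>path_algebra Q\<^esub> h) w =
      (\<Sum>i\<le>length es. \<Sum>j\<le>i. F j (i - j))"
    unfolding w path_algebra_mult sum_distrib_right
    by (intro sum.cong) (auto simp: F_def e_def drop_take min_def)
  also have "\<dots> = (\<Sum>(j, k)\<in>{(j, k). j + k \<le> length es}. F j k)"
    by (rule sum.triangle_reindex_eq[symmetric])
  also have "{(j, k). j + k \<le> length es} = (SIGMA j:{..length es}. {..length es - j})"
    by auto
  also have "(\<Sum>(j, k)\<in>(SIGMA j:{..length es}. {..length es - j}). F j k) =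
      (\<Sum>j\<le>length es. \<Sum>k\<le>length es - j. F j k)"
    by (rule sum.Sigma[symmetric]) auto
  also have "\<dots> = (f \<otimes>\<^bsub>path_algebra Q\<^esub> (g \<otimes>\<^bsub>path_algebra Q\<^esub> h)) w"
    unfolding w path_algebra_mult sum_distrib_left
    by (intro sum.cong)
       (auto simp: F_def e_def path_end_append take_add[symmetric] mult.assoc add.commute)
  finally show "(f \<otimes>\<^bsub>path_algebra Q\<^esub> g \<otimes>\<^bsub>path_algebra Q\<^esub> h) w =
      (f \<otimes>\<^bsub>path_algebra Q\<^esub> (g \<otimes>\<^bsub>path_algebra Q\<^esub> h)) w" .
qed

lemma path_algebra_one_mult:
  assumes "f \<in> carrier (path_algebra Q)"
  shows "\<one>\<^bsub>path_algebra Q\<^esub> \<otimes>\<^bsub>path_algebra Q\<^esub> f = f"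
proof
  fix w :: "'a \<times> 'b list"
  obtain u es where w: "w = (u, es)" by (cases w)
  have "(\<one>\<^bsub>path_algebra Q\<^esub> \<otimes>\<^bsub>path_algebra Q\<^esub> f) w =
      (\<Sum>i\<in>{0}. \<one>\<^bsub>path_algebra Q\<^esub> (u, take i es) * f (path_end Q u (take i es), drop i es))"
    unfolding w path_algebra_mult
    by (intro sum.mono_neutral_right) (auto simp: path_algebra_one)
  also have "\<dots> = f w"
    \<comment> \<open>A path starts at a vertex of \<open>Q\<close>, so where the identity has
      coefficient zero, \<open>f\<close> vanishes as well.\<close>
    using assms pre_digraph.awalk_def[of Q u es]
    by (auto simp: w path_algebra_one path_end_def path_algebra_carrier qpaths_def)
  finally show "(\<one>\<^bsub>path_algebra Q\<^esub> \<otimes>\<^bsub>path_algebra Q\<^esub> f) w = f w" .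
qed

lemma path_algebra_mult_one:
  assumes "wf_digraph Q" "f \<in> carrier (path_algebra Q)"
  shows "f \<otimes>\<^bsub>path_algebra Q\<^esub> \<one>\<^bsub>path_algebra Q\<^esub> = f"
proof
  fix w :: "'a \<times> 'b list"
  obtain u es where w: "w = (u, es)" by (cases w)
  have "(f \<otimes>\<^bsub>path_algebra Q\<^esub> \<one>\<^bsub>path_algebra Q\<^esub>) w =
      (\<Sum>i\<in>{length es}. f (u, take i es) * \<one>\<^bsub>path_algebra Q\<^esub> (path_end Q u (take i es), drop i es))"
    unfolding w path_algebra_mult
    by (intro sum.mono_neutral_right) (auto simp: path_algebra_one)
  also have "\<dots> = f w"
    using assms(2) path_end_in_verts[OF assms(1), of u es]
    by (auto simp: w path_algebra_one path_algebra_carrier)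
  finally show "(f \<otimes>\<^bsub>path_algebra Q\<^esub> \<one>\<^bsub>path_algebra Q\<^esub>) w = f w" .
qed

lemma path_algebra_add_closed:
  fixes f :: "('v, 'e) qpath \<Rightarrow> 'k::field"
  assumes "f \<in> carrier (path_algebra Q)" "g \<in> carrier (path_algebra Q)"
  shows "f \<oplus>\<^bsub>path_algebra Q\<^esub> g \<in> carrier (path_algebra Q)"
proof -
  have "{w. f w + g w \<noteq> 0} \<subseteq> {w. f w \<noteq> 0} \<union> {w. g w \<noteq> 0}" by auto
  with assms show ?thesis
    unfolding path_algebra_carrier path_algebra_add
    by (metis (no_types, lifting) add_0 finite_Un finite_subset)
qed

lemma path_algebra_scale_closed:
  "f \<in> carrier (path_algebra Q) \<Longrightarrow> (\<lambda>w. c * f w) \<in> carrier (path_algebra Q)"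
  unfolding path_algebra_carrier by (auto elim!: rev_finite_subset)

text \<open>The identity is the sum of all trivial paths; finitely many vertices make its support
  finite.\<close>

lemma path_algebra_one_closed:
  assumes "finite (verts Q)"
  shows "\<one>\<^bsub>path_algebra Q\<^esub> \<in> carrier (path_algebra Q :: (('v, 'e) qpath \<Rightarrow> 'k::field) ring)"
proof -
  have "{w. \<one>\<^bsub>path_algebra Q\<^esub> w \<noteq> (0::'k)} \<subseteq> verts Q \<times> {[]}"
    by (auto simp: path_algebra_one split: if_splits)
  then have "finite {w. \<one>\<^bsub>path_algebra Q\<^esub> w \<noteq> (0::'k)}"
    by (rule finite_subset) (simp add: assms)
  then show ?thesis
    by (auto simp: path_algebra_carrier path_algebra_one qpaths_Nil split: if_splits)
qed

lemma path_algebra_ring: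
  assumes "wf_digraph Q" "finite (verts Q)"
  shows "ring (path_algebra Q :: (('v, 'e) qpath \<Rightarrow> 'k::field) ring)" (is "ring ?R")
proof (rule ringI)
  show "abelian_group ?R"
  proof (rule abelian_groupI)
    fix f assume f: "f \<in> carrier ?R"
    show "\<exists>g\<in>carrier ?R. g \<oplus>\<^bsub>?R\<^esub> f = \<zero>\<^bsub>?R\<^esub>"
      using path_algebra_scale_closed[OF f, of "-1"]
      by (intro bexI) (auto simp: path_algebra_add path_algebra_zero)
  qed (simp_all add: path_algebra_add_closed, simp_all add: path_algebra_carrier path_algebra_zero
        path_algebra_add add_ac)
  show "Group.monoid ?R"
    by (intro monoidI path_algebra_mult_closed path_algebra_one_closed path_algebra_mult_assoc
        path_algebra_one_mult path_algebra_mult_one assms)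
qed (auto simp: fun_eq_iff path_algebra_mult path_algebra_add distrib_left distrib_right sum.distrib)

section \<open>Ideals generated by paths of length two\<close>

text \<open>A pair of arrows determines the path of length two, whose start is the tail of the first
  arrow. With \<open>B\<close> left abstract, the notion serves both for \<open>Q\<close> and for
  the quiver of the surface.\<close>

definition contains_pair :: "('e \<times> 'e) set \<Rightarrow> 'e list \<Rightarrow> bool" where
  "contains_pair B es \<longleftrightarrow> (\<exists>xs a b ys. es = xs @ a # b # ys \<and> (a, b) \<in> B)"

lemma contains_pair_append:
  "contains_pair B es \<or> contains_pair B fs \<Longrightarrow> contains_pair B (es @ fs)"
  unfolding contains_pair_def by (metis append.assoc append_Cons)

text \<open>Multiplication from either side only lengthens the paths in a support, so a pair inside
  such a path survives.\<close>

lemma ideal_contains_pair: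
  assumes "wf_digraph Q" "finite (verts Q)"
  shows "ideal {f \<in> carrier (path_algebra Q :: (('v, 'e) qpath \<Rightarrow> 'k::field) ring).
    \<forall>w. f w \<noteq> 0 \<longrightarrow> contains_pair B (snd w)} (path_algebra Q)" (is "ideal ?J ?R")
proof (rule idealI)
  interpret ring ?R using assms by (rule path_algebra_ring)
  show "ring ?R" ..
  show "subgroup ?J (add_monoid ?R)"
  proof (rule add.subgroupI)
    show "?J \<noteq> {}"
      by (intro ex_in_conv[THEN iffD1] exI[of _ "\<lambda>_. 0"]) (simp add: path_algebra_carrier)
    fix f assume f: "f \<in> ?J"
    then have "(\<lambda>w. - 1 * f w) \<oplus>\<^bsub>?R\<^esub> f = \<zero>\<^bsub>?R\<^esub>" "(\<lambda>w. - 1 * f w) \<in> carrier ?R"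
      using path_algebra_scale_closed[of f Q "-1"] by (auto simp: path_algebra_add path_algebra_zero)
    then have "\<ominus>\<^bsub>?R\<^esub> f = (\<lambda>w. - 1 * f w)"
      using f by (intro minus_equality) auto
    with f show "\<ominus>\<^bsub>?R\<^esub> f \<in> ?J" 
      using path_algebra_scale_closed[of f Q "-1"] by simp
    fix g assume "g \<in> ?J"
    with f show "f \<oplus>\<^bsub>?R\<^esub> g \<in> ?J"
      by (simp add: path_algebra_add_closed) (metis path_algebra_add add_0)
  qed auto
  fix f g assume "f \<in> ?J" "g \<in> carrier ?R"
  then show "g \<otimes>\<^bsub>?R\<^esub> f \<in> ?J" "f \<otimes>\<^bsub>?R\<^esub> g \<in> ?J"
    by (auto simp: path_algebra_mult_closed[OF assms(1)]
        elim!: path_algebra_mult_nonzero intro!: contains_pair_append)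
qed

text \<open>The generated ideal is contained in every ideal containing the generators, in particular
  in the one defined by supports.\<close>

lemma genideal_contains_pair:
  fixes f :: "('v, 'e) qpath \<Rightarrow> 'k::field"
  assumes "wf_digraph Q" "finite (verts Q)"
    and W: "W \<subseteq> qpaths Q" "\<And>w. w \<in> W \<Longrightarrow> contains_pair B (snd w)"
    and f: "f \<in> Idl\<^bsub>path_algebra Q\<^esub> (path_elem ` W)" "f w \<noteq> 0"
  shows "contains_pair B (snd w)"
proof -
  let ?J = "{f \<in> carrier (path_algebra Q :: (('v, 'e) qpath \<Rightarrow> 'k::field) ring).
    \<forall>w. f w \<noteq> 0 \<longrightarrow> contains_pair B (snd w)}"
  have "path_elem ` W \<subseteq> ?J"
    using W by (auto simp: path_elem_def path_algebra_carrier split: if_splits)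
  then have "f \<in> ?J"
    using f(1) ideal_contains_pair[OF assms(1,2)] unfolding genideal_def by blast
  with f(2) show ?thesis by blast
qed

section \<open>String modules\<close>

definition walk_in :: "('v, 'e) pre_digraph \<Rightarrow> 'v list \<Rightarrow> ('e \<times> bool) list \<Rightarrow> bool" where
  "walk_in Q xs ls \<longleftrightarrow> length xs = Suc (length ls) \<and> set xs \<subseteq> verts Q \<and>
     (\<forall>j<length ls. case ls ! j of (a, d) \<Rightarrow> a \<in> arcs Q \<and>
        tail Q a = xs ! (if d then j else Suc j) \<and> head Q a = xs ! (if d then Suc j else j))"

text \<open>Two consecutive inverse letters spell their path from right to left, whence the reversed
  pair in the second clause.\<close>

definition avoids_pairs :: "('e \<times> 'e) set \<Rightarrow> ('e \<times> bool) list \<Rightarrow> bool" where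
  "avoids_pairs B ls \<longleftrightarrow> (\<forall>j a b. Suc j < length ls \<longrightarrow>
     (ls ! j = (a, True) \<and> ls ! Suc j = (b, True) \<longrightarrow> (a, b) \<notin> B) \<and>
     (ls ! j = (a, False) \<and> ls ! Suc j = (b, False) \<longrightarrow> (b, a) \<notin> B))"

text \<open>The action of the path algebra itself. Unlike the scalar multiplication of the module,
  it involves no choice of a representative.\<close>

definition string_act :: "'v list \<Rightarrow> ('e \<times> bool) list \<Rightarrow> (('v, 'e) qpath \<Rightarrow> 'k::field) \<Rightarrow>
    (nat \<Rightarrow> 'k) \<Rightarrow> nat \<Rightarrow> 'k" where
  "string_act xs ls f m = (\<lambda>j. \<Sum>w | f w \<noteq> 0. f w * string_path xs ls w m j)"

section \<open>Linearity and composition of the action of paths\<close>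

lemma string_path_Nil: "string_path xs ls (u, []) m = string_idem xs u m"
  by (simp add: string_path_def)

lemma string_path_snoc:
  "string_path xs ls (u, es @ [a]) m = string_arrow xs ls a (string_path xs ls (u, es) m)"
  by (simp add: string_path_def)

lemma string_path_zero: "string_path xs ls w (\<lambda>_. 0) = (\<lambda>_. 0)"
proof (cases w)
  case (Pair u es)
  have "string_path xs ls (u, es) (\<lambda>_. 0) = (\<lambda>_. 0)"
    by (induction es rule: rev_induct)
       (simp_all add: string_path_Nil string_path_snoc string_idem_def string_arrow_def)
  with Pair show ?thesis by simp
qed

lemma string_path_add:
  "string_path xs ls w (\<lambda>j. m j + n j) = (\<lambda>j. string_path xs ls w m j + string_path xs ls w n j)"
proof (cases w)
  case (Pair u es)
  have "string_path xs ls (u, es) (\<lambda>j. m j + n j) =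
      (\<lambda>j. string_path xs ls (u, es) m j + string_path xs ls (u, es) n j)"
    by (induction es rule: rev_induct)
       (auto simp: string_path_Nil string_path_snoc string_idem_def string_arrow_def)
  with Pair show ?thesis by simp
qed

lemma string_path_scale:
  "string_path xs ls w (\<lambda>j. c * m j) = (\<lambda>j. c * string_path xs ls w m j)"
proof (cases w)
  case (Pair u es)
  have "string_path xs ls (u, es) (\<lambda>j. c * m j) = (\<lambda>j. c * string_path xs ls (u, es) m j)"
    by (induction es rule: rev_induct)
       (auto simp: string_path_Nil string_path_snoc string_idem_def string_arrow_def algebra_simps)
  with Pair show ?thesis by simp
qed

lemma string_path_support: "string_path xs ls w m j \<noteq> 0 \<Longrightarrow> j < length xs"
proof (cases w)
  case (Pair u es)
  show "string_path xs ls w m j \<noteq> 0 \<Longrightarrow> j < length xs"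
    unfolding Pair by (cases es rule: rev_cases)
      (auto simp: string_path_Nil string_path_snoc string_idem_def string_arrow_def split: if_splits)
qed

text \<open>In either reading direction a letter carries a vector to the position at the head of its
  arrow, so the last arrow of a path determines where its image is supported.\<close>

lemma string_path_end:
  assumes "walk_in Q xs ls" "string_path xs ls (u, es) m j \<noteq> 0"
  shows "xs ! j = path_end Q u es"
proof (cases es rule: rev_cases)
  case Nil
  with assms(2) show ?thesis
    by (auto simp: string_path_Nil string_idem_def path_end_def split: if_splits)
next
  case (snoc fs a)
  with assms(2) have "(0 < j \<and> j < length xs \<and> ls ! (j - 1) = (a, True)) \<or>
      (j + 1 < length xs \<and> ls ! j = (a, False))"
    by (auto simp: string_path_snoc string_arrow_def split: if_splits)
  then have "head Q a = xs ! j"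
  proof
    assume j: "0 < j \<and> j < length xs \<and> ls ! (j - 1) = (a, True)"
    with assms(1) have "j - 1 < length ls" by (auto simp: walk_in_def)
    with j assms(1) show ?thesis unfolding walk_in_def by fastforce
  next
    assume j: "j + 1 < length xs \<and> ls ! j = (a, False)"
    with assms(1) have "j < length ls" by (auto simp: walk_in_def)
    with j assms(1) show ?thesis unfolding walk_in_def by fastforce
  qed
  with snoc show ?thesis by (simp add: path_end_def)
qed

text \<open>The image of the first path is supported at its end vertex, so the start idempotent of
  the second path is the identity on it if the paths compose and zero otherwise.\<close>

lemma string_path_append:
  assumes "walk_in Q xs ls"
  shows "string_path xs ls (v, fs) (string_path xs ls (u, es) m) =
    (if v = path_end Q u es then string_path xs ls (u, es @ fs) m else (\<lambda>_. 0))"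
proof -
  have "string_idem xs v (string_path xs ls (u, es) m) =
      (if v = path_end Q u es then string_path xs ls (u, es) m else (\<lambda>_. 0))"
    using string_path_end[OF assms, of u es m] string_path_support[of xs ls "(u, es)" m]
    by (auto simp: string_idem_def fun_eq_iff)
  moreover have "fold (string_arrow xs ls) fs (\<lambda>_. 0) = (\<lambda>_. 0)"
    by (induction fs) (simp_all add: string_arrow_def)
  ultimately show ?thesis
    by (auto simp: string_path_def)
qed

text \<open>Two arrows can move a coordinate only by two steps in one direction: a step forth and
  back would read the same letter both as an arrow and as an inverse. The two steps in one direction
  are what \<open>avoids_pairs\<close> excludes.\<close>

lemma string_path_contains_pair:
  assumes ls: "length xs = Suc (length ls)" "avoids_pairs B ls" and w: "contains_pair B (snd w)"
  shows "string_path xs ls w m = (\<lambda>_. 0)"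
proof -
  obtain es a b fs where es: "snd w = es @ a # b # fs" and ab: "(a, b) \<in> B"
    using w unfolding contains_pair_def by blast
  have "string_arrow xs ls b (string_arrow xs ls a n) = (\<lambda>_. 0)" for n :: "nat \<Rightarrow> 'c"
  proof
    fix j
    have "\<not> (ls ! (j - 2) = (a, True) \<and> ls ! (j - 1) = (b, True))" if "1 < j" "j < length xs"
    proof -
      from that ls(1) have "Suc (j - 2) < length ls" "Suc (j - 2) = j - 1" by auto
      with ls(2) ab show ?thesis unfolding avoids_pairs_def by metis
    qed
    moreover have "\<not> (ls ! (j + 1) = (a, False) \<and> ls ! j = (b, False))" if "j + 2 < length xs"
    proof -
      from that ls(1) have "Suc j < length ls" "Suc j = j + 1" by auto
      with ls(2) ab show ?thesis unfolding avoids_pairs_def by metis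
    qed
    ultimately show "string_arrow xs ls b (string_arrow xs ls a n) j = 0"
      by (auto simp: string_arrow_def numeral_2_eq_2)
  qed
  moreover have "fold (string_arrow xs ls) fs (\<lambda>_. 0) = (\<lambda>_. 0)"
    by (induction fs) (simp_all add: string_arrow_def)
  ultimately show ?thesis
    by (simp add: string_path_def es)
qed

text \<open>Sums attached to different elements of the algebra become comparable over a common
  finite index set.\<close>

lemma string_act_eq_sum:
  assumes "finite W" "{w. f w \<noteq> 0} \<subseteq> W"
  shows "string_act xs ls f m j = (\<Sum>w\<in>W. f w * string_path xs ls w m j)"
  unfolding string_act_def using assms by (intro sum.mono_neutral_left) auto

lemma string_act_add_right:
  "string_act xs ls f (\<lambda>j. m j + n j) = (\<lambda>j. string_act xs ls f m j + string_act xs ls f n j)"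
  by (simp add: string_act_def string_path_add distrib_left sum.distrib)

lemma string_act_support: "length xs \<le> j \<Longrightarrow> string_act xs ls f m j = 0"
  unfolding string_act_def using string_path_support[of xs ls _ m j]
  by (intro sum.neutral) auto

lemma string_act_add:
  assumes "f \<in> carrier (path_algebra Q)" "g \<in> carrier (path_algebra Q)"
  shows "string_act xs ls (f \<oplus>\<^bsub>path_algebra Q\<^esub> g) m =
    (\<lambda>j. string_act xs ls f m j + string_act xs ls g m j)"
proof
  fix j
  let ?W = "{w. f w \<noteq> 0} \<union> {w. g w \<noteq> 0}"
  have W: "finite ?W" "{w. (f \<oplus>\<^bsub>path_algebra Q\<^esub> g) w \<noteq> 0} \<subseteq> ?W"
    using assms by (auto simp: path_algebra_carrier path_algebra_add)
  show "string_act xs ls (f \<oplus>\<^bsub>path_algebra Q\<^esub> g) m j =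
      string_act xs ls f m j + string_act xs ls g m j"
    unfolding string_act_eq_sum[OF W] string_act_eq_sum[OF W(1), of f, simplified]
      string_act_eq_sum[OF W(1), of g, simplified]
    by (simp add: path_algebra_add distrib_right sum.distrib)
qed

lemma string_act_scale:
  "string_act xs ls (\<lambda>w. c * f w) m = (\<lambda>j. c * string_act xs ls f m j)"
  by (cases "c = 0") (auto simp: string_act_def sum_distrib_left mult.assoc)

text \<open>Each position carries exactly one vertex, so exactly one of the trivial paths reproduces
  its coordinate and the others annihilate it.\<close>

lemma string_act_one:
  fixes m :: "nat \<Rightarrow> 'k::field"
  assumes "finite (verts Q)" "set xs \<subseteq> verts Q" "\<forall>j\<ge>length xs. m j = 0"
  shows "string_act xs ls \<one>\<^bsub>path_algebra Q\<^esub> m = m"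
proof
  fix j
  let ?W = "(\<lambda>u. (u, [])) ` verts Q"
  have W: "finite ?W" "{w. \<one>\<^bsub>path_algebra Q\<^esub> w \<noteq> (0::'k)} \<subseteq> ?W"
    using assms(1) by (auto simp: path_algebra_one split: if_splits)
  have "string_act xs ls \<one>\<^bsub>path_algebra Q\<^esub> m j = (\<Sum>u\<in>verts Q. string_idem xs u m j)"
    unfolding string_act_eq_sum[OF W]
    by (subst sum.reindex) (auto simp: inj_on_def path_algebra_one string_path_Nil)
  also have "\<dots> = m j"
  proof (cases "j < length xs")
    case True
    then have "(\<Sum>u\<in>verts Q. string_idem xs u m j) = (\<Sum>u\<in>verts Q. if u = xs ! j then m j else 0)"
      by (intro sum.cong) (auto simp: string_idem_def)
    moreover have "xs ! j \<in> verts Q" using assms(2) nth_mem[OF True] by blast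
    ultimately show ?thesis using assms(1) by simp
  qed (use assms(3) in \<open>simp add: string_idem_def\<close>)
  finally show "string_act xs ls \<one>\<^bsub>path_algebra Q\<^esub> m j = m j" .
qed

text \<open>The length of the initial part is traded for the composable pair of paths, so that the
  pairs with a given concatenation form a fibre of \<open>cat\<close>.\<close>

lemma path_algebra_mult_as_pairs:
  fixes f :: "('v, 'e) qpath \<Rightarrow> 'k::field"
  assumes f: "f \<in> carrier (path_algebra Q)" and g: "g \<in> carrier (path_algebra Q)"
  defines "PP \<equiv> {((u, es), (v, fs)). f (u, es) \<noteq> 0 \<and> g (v, fs) \<noteq> 0 \<and> v = path_end Q u es}"
    and "cat \<equiv> \<lambda>(v, w). (fst v, snd v @ snd w)"
  shows "(f \<otimes>\<^bsub>path_algebra Q\<^esub> g) w = (\<Sum>p\<in>{p\<in>PP. cat p = w}. f (fst p) * g (snd p))"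
proof -
  obtain u es where w: "w = (u, es)" by (cases w)
  let ?F = "\<lambda>i. f (u, take i es) * g (path_end Q u (take i es), drop i es)"
  have "(f \<otimes>\<^bsub>path_algebra Q\<^esub> g) w = (\<Sum>i\<in>{i. i \<le> length es \<and> ?F i \<noteq> 0}. ?F i)"
    unfolding w path_algebra_mult by (intro sum.mono_neutral_right) auto
  also have "\<dots> = (\<Sum>p\<in>{p\<in>PP. cat p = w}. f (fst p) * g (snd p))"
    by (rule sum.reindex_bij_witness[of _ "\<lambda>p. length (snd (fst p))"
          "\<lambda>i. ((u, take i es), (path_end Q u (take i es), drop i es))"])
       (auto simp: PP_def cat_def w)
  finally show ?thesis .
qed

text \<open>The first factor \<open>f\<close> acts first, as a right action requires. The single sum
  over concatenations is split into its fibres and compared with the double sum over both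
  supports.\<close>

lemma string_act_mult:
  fixes f :: "('v, 'e) qpath \<Rightarrow> 'k::field"
  assumes Q: "wf_digraph Q" and walk: "walk_in Q xs ls"
    and f: "f \<in> carrier (path_algebra Q)" and g: "g \<in> carrier (path_algebra Q)"
  shows "string_act xs ls (f \<otimes>\<^bsub>path_algebra Q\<^esub> g) m = string_act xs ls g (string_act xs ls f m)"
proof
  fix j
  let ?F = "{w. f w \<noteq> 0}" and ?G = "{w. g w \<noteq> 0}"
  define PP where "PP = {((u, es), (v, fs)). f (u, es) \<noteq> 0 \<and> g (v, fs) \<noteq> 0 \<and> v = path_end Q u es}"
  define cat :: "('v, 'e) qpath \<times> ('v, 'e) qpath \<Rightarrow> ('v, 'e) qpath"
    where "cat = (\<lambda>(v, w). (fst v, snd v @ snd w))"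
  have fin: "finite ?F" "finite ?G"
    using f g by (auto simp: path_algebra_carrier)
  have PP: "PP \<subseteq> ?F \<times> ?G" by (auto simp: PP_def)
  then have finPP: "finite PP" using fin finite_subset by blast
  have mult: "(f \<otimes>\<^bsub>path_algebra Q\<^esub> g) w = (\<Sum>p\<in>{p\<in>PP. cat p = w}. f (fst p) * g (snd p))" for w
    unfolding PP_def cat_def by (rule path_algebra_mult_as_pairs[OF f g])
  have sub: "{w. (f \<otimes>\<^bsub>path_algebra Q\<^esub> g) w \<noteq> 0} \<subseteq> cat ` PP"
    unfolding mult by (auto elim!: sum.not_neutral_contains_not_neutral intro: rev_image_eqI)
  have comp: "string_path xs ls (snd p) (string_path xs ls (fst p) m) =
      (if p \<in> PP then string_path xs ls (cat p) m else (\<lambda>_. 0))" if "p \<in> ?F \<times> ?G" for p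
    using that by (auto simp: PP_def cat_def string_path_append[OF walk])
  have lin: "string_path xs ls w (\<lambda>j. \<Sum>v\<in>V. c v * n v j) = (\<lambda>j. \<Sum>v\<in>V. c v * string_path xs ls w (n v) j)"
    if "finite V" for V w and c :: "('v, 'e) qpath \<Rightarrow> 'k" and n
    using that by (induction V) (simp_all add: string_path_zero string_path_add string_path_scale)
  have "string_act xs ls (f \<otimes>\<^bsub>path_algebra Q\<^esub> g) m j =
      (\<Sum>w\<in>cat ` PP. \<Sum>p\<in>{p\<in>PP. cat p = w}. f (fst p) * g (snd p) * string_path xs ls (cat p) m j)"
    unfolding string_act_eq_sum[OF finite_imageI[OF finPP] sub] mult sum_distrib_right
    by (intro sum.cong) auto
  also have "\<dots> = (\<Sum>p\<in>PP. f (fst p) * g (snd p) * string_path xs ls (cat p) m j)"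
    by (rule sum.image_gen[OF finPP, symmetric])
  \<comment> \<open>Non-composable pairs may be added because they act by zero; over the full
    product of the supports the two sums separate.\<close>
  also have "\<dots> = (\<Sum>p\<in>?F \<times> ?G. f (fst p) * g (snd p) *
      string_path xs ls (snd p) (string_path xs ls (fst p) m) j)"
  proof (intro sum.mono_neutral_cong_left ballI)
    show "finite (?F \<times> ?G)" using fin by simp
    show "f (fst p) * g (snd p) * string_path xs ls (snd p) (string_path xs ls (fst p) m) j = 0"
      if "p \<in> ?F \<times> ?G - PP" for p
      using that comp[of p] by simp
    show "f (fst p) * g (snd p) * string_path xs ls (cat p) m j =
        f (fst p) * g (snd p) * string_path xs ls (snd p) (string_path xs ls (fst p) m) j"
      if "p \<in> PP" for p
      using that comp[OF subsetD[OF PP that]] by simp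
  qed (rule PP)
  also have "\<dots> = (\<Sum>v\<in>?F. \<Sum>w\<in>?G. g w * (f v * string_path xs ls w (string_path xs ls v m) j))"
    by (simp add: sum.cartesian_product' mult_ac)
  also have "\<dots> = (\<Sum>w\<in>?G. \<Sum>v\<in>?F. g w * (f v * string_path xs ls w (string_path xs ls v m) j))"
    by (rule sum.swap)
  also have "\<dots> = string_act xs ls g (string_act xs ls f m) j"
    by (simp add: string_act_def lin fin sum_distrib_left)
  finally show "string_act xs ls (f \<otimes>\<^bsub>path_algebra Q\<^esub> g) m j =
      string_act xs ls g (string_act xs ls f m) j" .
qed

lemma string_module_simps:
  "carrier (string_module xs ls) = {m. \<forall>j\<ge>length xs. m j = 0}"
  "\<zero>\<^bsub>string_module xs ls\<^esub> = (\<lambda>_. 0)"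
  "m \<oplus>\<^bsub>string_module xs ls\<^esub> n = (\<lambda>j. m j + n j)"
  "X \<odot>\<^bsub>string_module xs ls\<^esub> m = string_act xs ls (SOME f. f \<in> X) m"
  by (simp_all add: string_module_def string_act_def Let_def)

text \<open>The ideal enters through a bound on supports and the walk through the pairs it avoids.
  Both conditions are inherited by contiguous pieces of the walk, so the pieces need no further
  geometry.\<close>

locale string_walk =
  fixes Q :: "('v, 'e) pre_digraph" and I :: "(('v, 'e) qpath \<Rightarrow> 'k::field) set"
    and B :: "('e \<times> 'e) set" and xs :: "'v list" and ls :: "('e \<times> bool) list"
  assumes Q: "fin_digraph Q" and I: "ideal I (path_algebra Q)"
    and B: "\<And>f w. \<lbrakk>f \<in> I; f w \<noteq> 0\<rbrakk> \<Longrightarrow> contains_pair B (snd w)"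
    and walk: "walk_in Q xs ls" and avoids: "avoids_pairs B ls"
begin

lemma wf: "wf_digraph Q" and fin: "finite (verts Q)"
  using Q by (simp_all add: fin_digraph_def fin_digraph_axioms_def)

lemma string_act_ideal:
  assumes "f \<in> I"
  shows "string_act xs ls f m = (\<lambda>_. 0)"
proof -
  have "length xs = Suc (length ls)" using walk by (simp add: walk_in_def)
  then have "string_path xs ls w m = (\<lambda>_. 0)" if "f w \<noteq> 0" for w
    using string_path_contains_pair[OF _ avoids] B[OF assms that] by blast
  then show ?thesis
    by (auto simp: string_act_def intro!: sum.neutral)
qed

text \<open>The chosen representative differs from \<open>f\<close> by an element of the ideal,
  which acts by zero.\<close>

lemma smult_coset:
  assumes "f \<in> carrier (path_algebra Q)"
  shows "(I +>\<^bsub>path_algebra Q\<^esub> f) \<odot>\<^bsub>string_module xs ls\<^esub> m = string_act xs ls f m"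
proof -
  interpret ideal I "path_algebra Q" by (rule I)
  have "(SOME g. g \<in> I +>\<^bsub>path_algebra Q\<^esub> f) \<in> I +>\<^bsub>path_algebra Q\<^esub> f"
    using a_rcos_self[OF assms] by (rule someI[where P = "\<lambda>g. g \<in> I +>\<^bsub>path_algebra Q\<^esub> f"])
  then obtain h where h: "h \<in> I"
    and eq: "(SOME g. g \<in> I +>\<^bsub>path_algebra Q\<^esub> f) = h \<oplus>\<^bsub>path_algebra Q\<^esub> f"
    unfolding a_r_coset_def' by blast
  show ?thesis
    unfolding string_module_simps eq
    by (simp add: string_act_add[OF a_Hcarr[OF h] assms] string_act_ideal[OF h])
qed

lemma cosets:
  assumes "X \<in> carrier (path_algebra Q Quot I)"
  obtains f where "f \<in> carrier (path_algebra Q)" "X = I +>\<^bsub>path_algebra Q\<^esub> f"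
  using assms unfolding FactRing_simps by auto

lemma right_module: "right_module (path_algebra Q Quot I) (string_module xs ls)"
proof -
  interpret ideal I "path_algebra Q" by (rule I)
  let ?R = "path_algebra Q" and ?M = "string_module xs ls"
  note hom = ring_hom_add[OF rcos_ring_hom, symmetric] ring_hom_mult[OF rcos_ring_hom, symmetric]
    ring_hom_one[OF rcos_ring_hom, symmetric]
  have "abelian_group ?M"
  proof (rule abelian_groupI)
    fix m assume "m \<in> carrier ?M"
    then show "\<exists>n\<in>carrier ?M. n \<oplus>\<^bsub>?M\<^esub> m = \<zero>\<^bsub>?M\<^esub>"
      by (intro bexI[of _ "\<lambda>j. - m j"]) (auto simp: string_module_simps)
  qed (auto simp: string_module_simps add_ac)
  moreover have "X \<odot>\<^bsub>?M\<^esub> m \<in> carrier ?M" for X m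
    by (simp add: string_module_simps string_act_support)
  moreover have "X \<odot>\<^bsub>?M\<^esub> (m \<oplus>\<^bsub>?M\<^esub> n) = X \<odot>\<^bsub>?M\<^esub> m \<oplus>\<^bsub>?M\<^esub> X \<odot>\<^bsub>?M\<^esub> n" for X m n
    by (simp add: string_module_simps string_act_add_right)
  moreover have "(X \<oplus>\<^bsub>?R Quot I\<^esub> Y) \<odot>\<^bsub>?M\<^esub> m = X \<odot>\<^bsub>?M\<^esub> m \<oplus>\<^bsub>?M\<^esub> Y \<odot>\<^bsub>?M\<^esub> m"
    if XY: "X \<in> carrier (?R Quot I)" "Y \<in> carrier (?R Quot I)" for X Y m
  proof -
    obtain f g where "f \<in> carrier ?R" "X = I +>\<^bsub>?R\<^esub> f" "g \<in> carrier ?R" "Y = I +>\<^bsub>?R\<^esub> g"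
      using XY by (elim cosets)
    then show ?thesis
      by (simp add: hom smult_coset string_act_add string_module_simps(3))
  qed
  moreover have "(X \<otimes>\<^bsub>?R Quot I\<^esub> Y) \<odot>\<^bsub>?M\<^esub> m = Y \<odot>\<^bsub>?M\<^esub> (X \<odot>\<^bsub>?M\<^esub> m)"
    if XY: "X \<in> carrier (?R Quot I)" "Y \<in> carrier (?R Quot I)" for X Y m
  proof -
    obtain f g where "f \<in> carrier ?R" "X = I +>\<^bsub>?R\<^esub> f" "g \<in> carrier ?R" "Y = I +>\<^bsub>?R\<^esub> g"
      using XY by (elim cosets)
    then show ?thesis
      by (simp add: hom smult_coset string_act_mult[OF wf walk])
  qed
  moreover have "\<one>\<^bsub>?R Quot I\<^esub> \<odot>\<^bsub>?M\<^esub> m = m" if "m \<in> carrier ?M" for m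
    using that walk unfolding hom smult_coset[OF one_closed]
    by (intro string_act_one[OF fin]) (auto simp: walk_in_def string_module_simps)
  ultimately show ?thesis
    unfolding right_module_def using quotient_is_ring by blast
qed

text \<open>\<open>finitely_generated\<close> speaks of additive subgroups stable under the algebra,
  not of subspaces. The field is recovered from the multiples of the identity.\<close>

lemma scalar_action:
  assumes "m \<in> carrier (string_module xs ls)"
  obtains X where "X \<in> carrier (path_algebra Q Quot I)"
    "X \<odot>\<^bsub>string_module xs ls\<^esub> m = (\<lambda>j. c * m j)"
proof -
  interpret ideal I "path_algebra Q" by (rule I)
  let ?f = "\<lambda>w. c * \<one>\<^bsub>path_algebra Q\<^esub> w"
  have f: "?f \<in> carrier (path_algebra Q)"
    by (rule path_algebra_scale_closed[OF one_closed])
  have "string_act xs ls \<one>\<^bsub>path_algebra Q\<^esub> m = m"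
    using assms walk by (intro string_act_one[OF fin]) (auto simp: walk_in_def string_module_simps)
  then have "(I +>\<^bsub>path_algebra Q\<^esub> ?f) \<odot>\<^bsub>string_module xs ls\<^esub> m = (\<lambda>j. c * m j)"
    unfolding smult_coset[OF f] string_act_scale by simp
  with ring_hom_closed[OF rcos_ring_hom f] show thesis by (rule that)
qed

lemma finitely_generated: "finitely_generated (path_algebra Q Quot I) (string_module xs ls)"
proof -
  let ?M = "string_module xs ls :: ((('v, 'e) qpath \<Rightarrow> 'k) set, nat \<Rightarrow> 'k) module"
  define e :: "nat \<Rightarrow> nat \<Rightarrow> 'k" where "e i = (\<lambda>j. if j = i then 1 else 0)" for i
  have e: "e i \<in> carrier ?M" if "i < length xs" for i
    using that by (auto simp: e_def string_module_simps)
  have "N = carrier ?M"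
    if N: "e ` {..<length xs} \<subseteq> N" "subgroup N (add_monoid ?M)"
      and act: "\<forall>X\<in>carrier (path_algebra Q Quot I). \<forall>m\<in>N. X \<odot>\<^bsub>?M\<^esub> m \<in> N" for N
  proof
    interpret subgroup N "add_monoid ?M" by (rule N(2))
    show "N \<subseteq> carrier ?M" using subset by simp
    show "carrier ?M \<subseteq> N"
    proof
      fix m assume m: "m \<in> carrier ?M"
      \<comment> \<open>The truncations of \<open>m\<close> are built up one coordinate at a time;
        the one at \<open>length xs\<close> is \<open>m\<close> itself.\<close>
      have "(\<lambda>j. if j < k then m j else 0) \<in> N" if "k \<le> length xs" for k
        using that
      proof (induction k)
        case 0
        then show ?case using one_closed by (simp add: string_module_simps)
      next
        case (Suc k)
        then have k: "k < length xs" by simp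
        obtain X where "X \<in> carrier (path_algebra Q Quot I)" "X \<odot>\<^bsub>?M\<^esub> e k = (\<lambda>j. m k * e k j)"
          using scalar_action[OF e[OF k]] by metis
        moreover have "e k \<in> N" using N(1) k by blast
        ultimately have "(\<lambda>j. m k * e k j) \<in> N" using act by metis
        moreover have "(\<lambda>j. if j < k then m j else 0) \<in> N" using Suc by simp
        ultimately have "(\<lambda>j. (if j < k then m j else 0) + m k * e k j) \<in> N"
          using m_closed by (fastforce simp: string_module_simps)
        moreover have "(\<lambda>j. (if j < k then m j else 0) + m k * e k j) =
            (\<lambda>j. if j < Suc k then m j else 0)"
          by (auto simp: e_def fun_eq_iff less_Suc_eq)
        ultimately show ?case by simp
      qed
      from this[OF order_refl] show "m \<in> N"
        using m by (auto simp: string_module_simps not_less elim!: back_subst[of "\<lambda>x. x \<in> N"])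
    qed
  qed
  then show ?thesis
    unfolding finitely_generated_def using e by (intro exI[of _ "e ` {..<length xs}"]) auto
qed

lemma fg_right_module: "fg_right_module (path_algebra Q Quot I) (string_module xs ls)"
  by (simp add: fg_right_module_def right_module finitely_generated)

end

section \<open>Direct sums of finitely generated right modules\<close>

lemma module_sum_simps:
  "carrier (module_sum M N) = carrier M \<times> carrier N"
  "\<zero>\<^bsub>module_sum M N\<^esub> = (\<zero>\<^bsub>M\<^esub>, \<zero>\<^bsub>N\<^esub>)"
  "p \<oplus>\<^bsub>module_sum M N\<^esub> q = (fst p \<oplus>\<^bsub>M\<^esub> fst q, snd p \<oplus>\<^bsub>N\<^esub> snd q)"
  "X \<odot>\<^bsub>module_sum M N\<^esub> p = (X \<odot>\<^bsub>M\<^esub> fst p, X \<odot>\<^bsub>N\<^esub> snd p)"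
  by (simp_all add: module_sum_def split_beta)

lemma right_module_module_sum:
  assumes "right_module R M" "right_module R N"
  shows "right_module R (module_sum M N)"
proof -
  interpret M: abelian_group M using assms by (simp add: right_module_def)
  interpret N: abelian_group N using assms by (simp add: right_module_def)
  have "abelian_group (module_sum M N)"
  proof (rule abelian_groupI)
    fix p assume "p \<in> carrier (module_sum M N)"
    then show "\<exists>q\<in>carrier (module_sum M N). q \<oplus>\<^bsub>module_sum M N\<^esub> p = \<zero>\<^bsub>module_sum M N\<^esub>"
      by (intro bexI[of _ "(\<ominus>\<^bsub>M\<^esub> fst p, \<ominus>\<^bsub>N\<^esub> snd p)"])
         (auto simp: module_sum_simps M.l_neg N.l_neg)
  qed (auto simp: module_sum_simps M.a_ac N.a_ac)
  with assms show ?thesis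
    unfolding right_module_def by (simp add: module_sum_simps mem_Times_iff prod_eq_iff)
qed

text \<open>A stable subgroup \<open>K\<close> containing the generators of both summands meets each
  axis in a stable subgroup containing the generators of that summand, hence in all of it. Every
  pair is the sum of its two axis components.\<close>

lemma finitely_generated_module_sum:
  assumes M: "right_module R M" "finitely_generated R M"
    and N: "right_module R N" "finitely_generated R N"
  shows "finitely_generated R (module_sum M N)"
proof -
  interpret M: abelian_group M using M by (simp add: right_module_def)
  interpret N: abelian_group N using N by (simp add: right_module_def)
  interpret S: abelian_group "module_sum M N"
    using right_module_module_sum[OF M(1) N(1)] by (simp add: right_module_def)
  \<comment> \<open>Makes the axes stable: a zero component must stay zero under the action.\<close>
  have smult_zero: "r \<odot>\<^bsub>L\<^esub> \<zero>\<^bsub>L\<^esub> = \<zero>\<^bsub>L\<^esub>" if L: "right_module R L" and r: "r \<in> carrier R"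
    for L :: "('a, 'x) module" and r
  proof -
    interpret L: abelian_group L using L by (simp add: right_module_def)
    have "r \<odot>\<^bsub>L\<^esub> (\<zero>\<^bsub>L\<^esub> \<oplus>\<^bsub>L\<^esub> \<zero>\<^bsub>L\<^esub>) = r \<odot>\<^bsub>L\<^esub> \<zero>\<^bsub>L\<^esub> \<oplus>\<^bsub>L\<^esub> r \<odot>\<^bsub>L\<^esub> \<zero>\<^bsub>L\<^esub>"
      and "r \<odot>\<^bsub>L\<^esub> \<zero>\<^bsub>L\<^esub> \<in> carrier L"
      using L r L.zero_closed unfolding right_module_def by blast+
    then show ?thesis by simp
  qed
  obtain G H where G: "finite G" "G \<subseteq> carrier M"
      "\<And>K. \<lbrakk>G \<subseteq> K; subgroup K (add_monoid M); \<forall>r\<in>carrier R. \<forall>m\<in>K. r \<odot>\<^bsub>M\<^esub> m \<in> K\<rbrakk> \<Longrightarrow> K = carrier M"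
    and H: "finite H" "H \<subseteq> carrier N"
      "\<And>K. \<lbrakk>H \<subseteq> K; subgroup K (add_monoid N); \<forall>r\<in>carrier R. \<forall>m\<in>K. r \<odot>\<^bsub>N\<^esub> m \<in> K\<rbrakk> \<Longrightarrow> K = carrier N"
    using M(2) N(2) unfolding finitely_generated_def by metis
  let ?GH = "(\<lambda>g. (g, \<zero>\<^bsub>N\<^esub>)) ` G \<union> (\<lambda>h. (\<zero>\<^bsub>M\<^esub>, h)) ` H"
  have gen: "K = carrier (module_sum M N)"
    if K: "?GH \<subseteq> K" "subgroup K (add_monoid (module_sum M N))"
      and act: "\<forall>r\<in>carrier R. \<forall>p\<in>K. r \<odot>\<^bsub>module_sum M N\<^esub> p \<in> K" for K
  proof -
    interpret K: subgroup K "add_monoid (module_sum M N)" by (rule K(2))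
    have add: "(m \<oplus>\<^bsub>M\<^esub> m', n \<oplus>\<^bsub>N\<^esub> n') \<in> K" if "(m, n) \<in> K" "(m', n') \<in> K" for m n m' n'
      using K.m_closed[OF that] by (simp add: module_sum_simps)
    have zero: "(\<zero>\<^bsub>M\<^esub>, \<zero>\<^bsub>N\<^esub>) \<in> K"
      using K.one_closed by (simp add: module_sum_simps)
    have sub: "m \<in> carrier M" "n \<in> carrier N" if "(m, n) \<in> K" for m n
      using K.subset that by (auto simp: module_sum_simps)
    have neg: "(\<ominus>\<^bsub>M\<^esub> m, \<ominus>\<^bsub>N\<^esub> n) \<in> K" if mn: "(m, n) \<in> K" for m n
    proof -
      have "\<ominus>\<^bsub>module_sum M N\<^esub> (m, n) = (\<ominus>\<^bsub>M\<^esub> m, \<ominus>\<^bsub>N\<^esub> n)"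
        using sub[OF mn] by (intro S.minus_equality) (auto simp: module_sum_simps M.l_neg N.l_neg)
      then show ?thesis using K.m_inv_closed[OF mn] by (simp add: a_inv_def)
    qed
    let ?K1 = "{m. (m, \<zero>\<^bsub>N\<^esub>) \<in> K}" and ?K2 = "{n. (\<zero>\<^bsub>M\<^esub>, n) \<in> K}"
    have "subgroup ?K1 (add_monoid M)" "subgroup ?K2 (add_monoid N)"
      using zero sub neg[of _ "\<zero>\<^bsub>N\<^esub>"] neg[of "\<zero>\<^bsub>M\<^esub>"] add[of _ "\<zero>\<^bsub>N\<^esub>" _ "\<zero>\<^bsub>N\<^esub>"]
        add[of "\<zero>\<^bsub>M\<^esub>" _ "\<zero>\<^bsub>M\<^esub>"]
        M.minus_equality[of "\<zero>\<^bsub>M\<^esub>" "\<zero>\<^bsub>M\<^esub>"] N.minus_equality[of "\<zero>\<^bsub>N\<^esub>" "\<zero>\<^bsub>N\<^esub>"]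
      by (auto intro!: M.add.subgroupI N.add.subgroupI simp flip: a_inv_def)
    moreover have "G \<subseteq> ?K1" "H \<subseteq> ?K2" using K(1) by auto
    moreover have "\<forall>r\<in>carrier R. \<forall>m\<in>?K1. r \<odot>\<^bsub>M\<^esub> m \<in> ?K1"
      using act smult_zero[OF N(1)] by (fastforce simp: module_sum_simps)
    moreover have "\<forall>r\<in>carrier R. \<forall>m\<in>?K2. r \<odot>\<^bsub>N\<^esub> m \<in> ?K2"
      using act smult_zero[OF M(1)] by (fastforce simp: module_sum_simps)
    ultimately have K12: "?K1 = carrier M" "?K2 = carrier N"
      using G(3) H(3) by auto
    have "(m, n) \<in> K" if "m \<in> carrier M" "n \<in> carrier N" for m n
      using that K12 add[of m "\<zero>\<^bsub>N\<^esub>" "\<zero>\<^bsub>M\<^esub>" n] by auto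
    then show ?thesis using sub by (auto simp: module_sum_simps)
  qed
  show ?thesis
    unfolding finitely_generated_def
  proof (intro exI[of _ ?GH] conjI allI impI)
    show "finite ?GH" "?GH \<subseteq> carrier (module_sum M N)"
      using G(1,2) H(1,2) by (auto simp: module_sum_simps)
  qed (elim conjE, rule gen)
qed

lemma fg_right_module_module_sum:
  "fg_right_module R M \<Longrightarrow> fg_right_module R N \<Longrightarrow> fg_right_module R (module_sum M N)"
  by (simp add: fg_right_module_def right_module_module_sum finitely_generated_module_sum)


lemma short_exactI:
  assumes "fg_right_module R L" "fg_right_module R M" "fg_right_module R N"
    and "f \<in> right_module_hom R L M" "g \<in> right_module_hom R M N"
    and "inj_on f (carrier L)" "f ` carrier L = {m \<in> carrier M. g m = \<zero>\<^bsub>N\<^esub>}"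
    and "g ` carrier M = carrier N"
  shows "short_exact R L M N"
  using assms unfolding short_exact_def by blast

section \<open>Factors of strings\<close>

text \<open>\<open>n\<close> positions from \<open>a\<close> on are joined by \<open>n - 1\<close>
  letters; the letters \<open>a - 1\<close> and \<open>a + n - 1\<close>, if present, are the ones
  that are cut.\<close>

definition factor_module :: "'v list \<Rightarrow> ('e \<times> bool) list \<Rightarrow> nat \<Rightarrow> nat \<Rightarrow>
    ((('v, 'e) qpath \<Rightarrow> 'k::field) set, nat \<Rightarrow> 'k) module" where
  "factor_module xs ls a n = string_module (take n (drop a xs)) (take (n - 1) (drop a ls))"

text \<open>Extension by zero, the candidate for the inclusion of a submodule.\<close>

definition shift_in :: "nat \<Rightarrow> nat \<Rightarrow> (nat \<Rightarrow> 'k::zero) \<Rightarrow> nat \<Rightarrow> 'k" where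
  "shift_in a n m = (\<lambda>j. if a \<le> j \<and> j < a + n then m (j - a) else 0)"

text \<open>Restriction of coordinates, the candidate for the projection onto a quotient.\<close>

definition shift_out :: "nat \<Rightarrow> nat \<Rightarrow> (nat \<Rightarrow> 'k::zero) \<Rightarrow> nat \<Rightarrow> 'k" where
  "shift_out a n m = (\<lambda>j. if j < n then m (a + j) else 0)"

lemma shift_out_eq_zero:
  "shift_out a n m = (\<lambda>_. 0) \<longleftrightarrow> (\<forall>j. a \<le> j \<and> j < a + n \<longrightarrow> m j = 0)"
proof
  assume *: "shift_out a n m = (\<lambda>_. 0)"
  have "m j = shift_out a n m (j - a)" if "a \<le> j \<and> j < a + n" for j
  proof -
    from that have "j - a < n" by linarith
    with that show ?thesis by (simp add: shift_out_def)
  qed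
  with * show "\<forall>j. a \<le> j \<and> j < a + n \<longrightarrow> m j = 0" by simp
qed (auto simp: shift_out_def)

lemma shift_out_add:
  fixes m m' :: "nat \<Rightarrow> 'k::monoid_add"
  shows "shift_out a n (\<lambda>j. m j + m' j) = (\<lambda>j. shift_out a n m j + shift_out a n m' j)"
  by (auto simp: shift_out_def)

lemma shift_out_shift_in_disjoint:
  "b + k \<le> a \<or> a + n \<le> b \<Longrightarrow> shift_out b k (shift_in a n m) = (\<lambda>_. 0)"
  by (auto simp: shift_out_def shift_in_def)

locale string_factor =
  fixes xs :: "'v list" and ls :: "('e \<times> bool) list" and a n :: nat
  assumes len: "length xs = Suc (length ls)" and n: "0 < n" "a + n \<le> length xs"
begin

abbreviation "xs' \<equiv> take n (drop a xs)"
abbreviation "ls' \<equiv> take (n - 1) (drop a ls)"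

lemma length_factor: "length xs' = n" "length ls' = n - 1"
  using len n by simp_all

lemma nth_factor: "j < n \<Longrightarrow> xs' ! j = xs ! (a + j)" "j < n - 1 \<Longrightarrow> ls' ! j = ls ! (a + j)"
  using len n by simp_all

lemma shift_in_add: "shift_in a n m (a + k) = (if k < n then m k else 0)"
  by (simp add: shift_in_def)

lemma shift_in_less: "j < a \<Longrightarrow> shift_in a n m j = 0"
  by (simp add: shift_in_def)

text \<open>Only the two cut letters join the factor to the rest of the walk. Both pointing inwards
  means that no arrow carries a vector out of the factor.\<close>

lemma shift_in_string_arrow:
  assumes "0 < a \<longrightarrow> snd (ls ! (a - 1))" "a + n < length xs \<longrightarrow> \<not> snd (ls ! (a + n - 1))"
  shows "string_arrow xs ls x (shift_in a n m) = shift_in a n (string_arrow xs' ls' x m)"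
proof
  fix j
  consider (less) "j < a" | (inside) i where "j = a + i" "i < n" | (ge) i where "j = a + i" "n \<le> i"
    by (metis le_Suc_ex linorder_not_less)
  then show "string_arrow xs ls x (shift_in a n m) j = shift_in a n (string_arrow xs' ls' x m) j"
  proof cases
    case less
    \<comment> \<open>Below \<open>a\<close> only position \<open>a - 1\<close> could receive
      something from the factor, through an inverse letter there.\<close>
    have "shift_in a n m (j + 1) = 0" if "ls ! j = (x, False)"
    proof -
      have "j + 1 \<noteq> a" using assms(1) that by auto
      with less show ?thesis by (intro shift_in_less) simp
    qed
    with less show ?thesis
      by (simp add: string_arrow_def shift_in_less)
  next
    case (inside i)
    have "(if 0 < j \<and> j < length xs \<and> ls ! (j - 1) = (x, True) then shift_in a n m (j - 1) else 0) =
        (if 0 < i \<and> i < n \<and> ls' ! (i - 1) = (x, True) then m (i - 1) else 0)"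
      using inside n nth_factor(2)[of "i - 1"]
      by (cases i) (simp_all add: shift_in_add shift_in_less)
    moreover have "(if j + 1 < length xs \<and> ls ! j = (x, False) then shift_in a n m (j + 1) else 0) =
        (if i + 1 < n \<and> ls' ! i = (x, False) then m (i + 1) else 0)"
      using inside n nth_factor(2)[of i] shift_in_add[of m "i + 1"]
      by (cases "i + 1 < n") simp_all
    ultimately show ?thesis
      using inside by (simp only: string_arrow_def shift_in_add length_factor simp_thms if_True)
  next
    case (ge i)
    \<comment> \<open>Beyond the factor only its first neighbour, \<open>i = n\<close>, could
      receive something, through a direct letter there.\<close>
    have "shift_in a n m (j - 1) = 0" if "0 < j" "j < length xs" "ls ! (j - 1) = (x, True)"
    proof -
      have "i \<noteq> n" using assms(2) that ge by auto
      with ge n shift_in_add[of m "i - 1"] show ?thesis by simp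
    qed
    moreover have "shift_in a n m (j + 1) = 0"
      using ge shift_in_add[of m "i + 1"] by simp
    ultimately show ?thesis
      using ge by (simp add: string_arrow_def shift_in_add)
  qed
qed

text \<open>Dually, both cut letters pointing outwards means that no arrow carries anything into the
  factor, so its coordinates can be computed from the factor alone.\<close>

lemma shift_out_string_arrow:
  assumes "0 < a \<longrightarrow> \<not> snd (ls ! (a - 1))" "a + n < length xs \<longrightarrow> snd (ls ! (a + n - 1))"
  shows "shift_out a n (string_arrow xs ls x m) = string_arrow xs' ls' x (shift_out a n m)"
proof
  fix j
  show "shift_out a n (string_arrow xs ls x m) j = string_arrow xs' ls' x (shift_out a n m) j"
  proof (cases "j < n")
    case True
    have "(if 0 < a + j \<and> a + j < length xs \<and> ls ! (a + j - 1) = (x, True) then m (a + j - 1) else 0) =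
        (if 0 < j \<and> j < n \<and> ls' ! (j - 1) = (x, True) then shift_out a n m (j - 1) else 0)"
      using True n assms(1) nth_factor(2)[of "j - 1"]
      by (cases j) (auto simp: shift_out_def)
    moreover have "(if a + j + 1 < length xs \<and> ls ! (a + j) = (x, False) then m (a + j + 1) else 0) =
        (if j + 1 < n \<and> ls' ! j = (x, False) then shift_out a n m (j + 1) else 0)"
    proof (cases "j + 1 < n")
      case True
      then show ?thesis using n nth_factor(2)[of j] by (simp add: shift_out_def)
    next
      case False
      with \<open>j < n\<close> have "a + n - 1 = a + j" "a + n = a + j + 1" by simp_all
      with False assms(2) show ?thesis by auto
    qed
    ultimately show ?thesis
      using True by (simp only: string_arrow_def shift_out_def length_factor simp_thms if_True)
  next
    case False
    then show ?thesis by (simp add: string_arrow_def length_factor shift_out_def)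
  qed
qed

lemma shift_in_string_idem:
  "string_idem xs u (shift_in a n m) = shift_in a n (string_idem xs' u m)"
proof
  fix j
  have "xs' ! (j - a) = xs ! j" if "a \<le> j" "j < a + n"
    using nth_factor(1)[of "j - a"] that by simp
  then show "string_idem xs u (shift_in a n m) j = shift_in a n (string_idem xs' u m) j"
    using n unfolding string_idem_def shift_in_def length_factor by auto
qed

lemma shift_out_string_idem:
  "shift_out a n (string_idem xs u m) = string_idem xs' u (shift_out a n m)"
  using n nth_factor(1) unfolding string_idem_def shift_out_def length_factor by auto

lemma shift_in_string_act:
  assumes "0 < a \<longrightarrow> snd (ls ! (a - 1))" "a + n < length xs \<longrightarrow> \<not> snd (ls ! (a + n - 1))"
  shows "string_act xs ls f (shift_in a n m) = shift_in a n (string_act xs' ls' f m)"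
proof -
  have "string_path xs ls (u, es) (shift_in a n m) = shift_in a n (string_path xs' ls' (u, es) m)" for u es
    by (induction es rule: rev_induct)
       (simp_all only: string_path_Nil string_path_snoc shift_in_string_idem
         shift_in_string_arrow[OF assms] simp_thms)
  then have path: "string_path xs ls w (shift_in a n m) = shift_in a n (string_path xs' ls' w m)" for w
    by (cases w) simp
  show ?thesis
    unfolding string_act_def path by (auto simp: shift_in_def fun_eq_iff)
qed

lemma shift_out_string_act:
  assumes "0 < a \<longrightarrow> \<not> snd (ls ! (a - 1))" "a + n < length xs \<longrightarrow> snd (ls ! (a + n - 1))"
  shows "shift_out a n (string_act xs ls f m) = string_act xs' ls' f (shift_out a n m)"
proof -
  have "shift_out a n (string_path xs ls (u, es) m) = string_path xs' ls' (u, es) (shift_out a n m)" for u es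
    by (induction es rule: rev_induct)
       (simp_all only: string_path_Nil string_path_snoc shift_out_string_idem
         shift_out_string_arrow[OF assms] simp_thms)
  then have path: "shift_out a n (string_path xs ls w m) = string_path xs' ls' w (shift_out a n m)" for w
    by (cases w) simp
  show ?thesis
    unfolding string_act_def path[symmetric] by (auto simp: shift_out_def fun_eq_iff)
qed

lemma factor_module_simps:
  "carrier (factor_module xs ls a n) = {m. \<forall>j\<ge>n. m j = 0}"
  "\<zero>\<^bsub>factor_module xs ls a n\<^esub> = (\<lambda>_. 0)"
  unfolding factor_module_def string_module_simps(1,2) length_factor by (rule refl)+

lemma shift_out_shift_in: "m \<in> carrier (factor_module xs ls a n) \<Longrightarrow> shift_out a n (shift_in a n m) = m"
  by (auto simp: factor_module_simps shift_in_def shift_out_def)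

lemma inj_on_shift_in: "inj_on (shift_in a n) (carrier (factor_module xs ls a n))"
  by (rule inj_on_inverseI) (rule shift_out_shift_in)

lemma shift_in_closed: "shift_in a n m \<in> carrier (string_module xs ls)"
  using n by (auto simp: string_module_simps shift_in_def)

lemma image_shift_in:
  fixes M :: "((('v, 'e) qpath \<Rightarrow> 'k::field) set, nat \<Rightarrow> 'k) module"
  defines "M \<equiv> factor_module xs ls a n"
  shows "shift_in a n ` carrier M = {m. \<forall>j. \<not> (a \<le> j \<and> j < a + n) \<longrightarrow> m j = 0}"
proof (intro equalityI subsetI)
  fix m :: "nat \<Rightarrow> 'k" assume "m \<in> {m. \<forall>j. \<not> (a \<le> j \<and> j < a + n) \<longrightarrow> m j = 0}"
  then have "m = shift_in a n (shift_out a n m)"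
    by (auto simp: shift_in_def shift_out_def fun_eq_iff)
  moreover have "shift_out a n m \<in> carrier M"
    by (simp add: M_def factor_module_simps shift_out_def)
  ultimately show "m \<in> shift_in a n ` carrier M" by (rule image_eqI)
qed (auto simp: shift_in_def)

lemma image_shift_out:
  fixes M :: "((('v, 'e) qpath \<Rightarrow> 'k::field) set, nat \<Rightarrow> 'k) module"
  defines "M \<equiv> factor_module xs ls a n"
  shows "shift_out a n ` carrier (string_module xs ls) = carrier M"
proof (intro equalityI subsetI)
  fix m assume "m \<in> carrier M"
  then show "m \<in> shift_out a n ` carrier (string_module xs ls)"
    unfolding M_def by (intro image_eqI[OF _ shift_in_closed]) (rule shift_out_shift_in[symmetric])
qed (auto simp: M_def factor_module_simps shift_out_def)

lemma shift_in_hom: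
  assumes "0 < a \<longrightarrow> snd (ls ! (a - 1))" "a + n < length xs \<longrightarrow> \<not> snd (ls ! (a + n - 1))"
  shows "shift_in a n \<in> right_module_hom R (factor_module xs ls a n) (string_module xs ls)"
  unfolding right_module_hom_def mem_Collect_eq factor_module_simps(1)
  unfolding factor_module_def string_module_simps shift_in_string_act[OF assms]
  using n(2) by (auto simp: shift_in_def)

lemma shift_out_hom:
  assumes "0 < a \<longrightarrow> \<not> snd (ls ! (a - 1))" "a + n < length xs \<longrightarrow> snd (ls ! (a + n - 1))"
  shows "shift_out a n \<in> right_module_hom R (string_module xs ls) (factor_module xs ls a n)"
  unfolding right_module_hom_def mem_Collect_eq factor_module_simps(1)
  unfolding factor_module_def string_module_simps shift_out_string_act[OF assms]
  using n(2) by (auto simp: shift_out_def)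

end

section \<open>Exact sequences from contiguous pieces of a walk\<close>

context string_walk
begin

lemma length_walk: "length xs = Suc (length ls)"
  using walk by (simp add: walk_in_def)

lemma factor:
  assumes "0 < n" "a + n \<le> length xs"
  shows "string_walk Q I B (take n (drop a xs)) (take (n - 1) (drop a ls))"
proof (rule string_walk.intro)
  interpret F: string_factor xs ls a n
    using assms length_walk by unfold_locales
  show "walk_in Q F.xs' F.ls'"
    unfolding walk_in_def
  proof (intro conjI allI impI)
    show "length F.xs' = Suc (length F.ls')"
      using F.length_factor assms(1) by simp
    show "set F.xs' \<subseteq> verts Q"
      using walk set_take_subset[of n "drop a xs"] set_drop_subset[of a xs]
      by (auto simp: walk_in_def)
    fix j assume "j < length F.ls'"
    then have j: "j < n - 1" by (simp add: F.length_factor)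
    moreover from j assms(2) length_walk have "a + j < length ls" by simp
    ultimately show "case F.ls' ! j of (x, d) \<Rightarrow> x \<in> arcs Q \<and>
        tail Q x = F.xs' ! (if d then j else Suc j) \<and> head Q x = F.xs' ! (if d then Suc j else j)"
      using walk F.nth_factor(1)[of j] F.nth_factor(1)[of "Suc j"]
      unfolding walk_in_def F.nth_factor(2)[OF j] by (auto split: prod.splits)
  qed
  show "avoids_pairs B F.ls'"
    unfolding avoids_pairs_def
  proof (intro allI impI)
    fix j x y assume "Suc j < length F.ls'"
    then have j: "j < n - 1" "Suc j < n - 1" by (simp_all add: F.length_factor)
    with assms(2) length_walk have "Suc (a + j) < length ls" by simp
    with avoids show "(F.ls' ! j = (x, True) \<and> F.ls' ! Suc j = (y, True) \<longrightarrow> (x, y) \<notin> B) \<and>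
        (F.ls' ! j = (x, False) \<and> F.ls' ! Suc j = (y, False) \<longrightarrow> (y, x) \<notin> B)"
      unfolding F.nth_factor(2)[OF j(1)] F.nth_factor(2)[OF j(2)]
      by (simp add: avoids_pairs_def)
  qed
qed (use Q I B in blast)+

lemma fg_factor_module:
  "0 < n \<Longrightarrow> a + n \<le> length xs \<Longrightarrow>
     fg_right_module (path_algebra Q Quot I) (factor_module xs ls a n)"
  unfolding factor_module_def by (rule string_walk.fg_right_module[OF factor])

text \<open>A factor of the walk spans a submodule if the letters next to it point towards it, and gives
  a quotient module if they point away from it.\<close>

lemma short_exact_split:
  assumes i: "0 < i" "i < length xs" and "\<not> snd (ls ! (i - 1))"
  shows "short_exact (path_algebra Q Quot I)
    (factor_module xs ls 0 i) (string_module xs ls) (factor_module xs ls i (length xs - i))"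
proof -
  let ?k = "length xs - i"
  interpret L: string_factor xs ls 0 i using i length_walk by unfold_locales auto
  interpret R: string_factor xs ls i ?k using i length_walk by unfold_locales auto
  have "shift_in 0 i \<in> right_module_hom (path_algebra Q Quot I)
      (factor_module xs ls 0 i) (string_module xs ls)"
    using assms by (intro L.shift_in_hom) auto
  moreover have "shift_out i ?k \<in> right_module_hom (path_algebra Q Quot I)
      (string_module xs ls) (factor_module xs ls i ?k)"
    using assms by (intro R.shift_out_hom) auto
  moreover have "\<not> (0 \<le> j \<and> j < 0 + i) \<longleftrightarrow> (i \<le> j \<and> j < i + ?k) \<or> length xs \<le> j" for j
    using i by auto
  then have "shift_in 0 i ` carrier (factor_module xs ls 0 i) =
      {m \<in> carrier (string_module xs ls). shift_out i ?k m = \<zero>\<^bsub>factor_module xs ls i ?k\<^esub>}"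
    unfolding L.image_shift_in R.factor_module_simps shift_out_eq_zero string_module_simps by blast
  ultimately show ?thesis
    using i by (intro short_exactI[of _ _ _ _ "shift_in 0 i" "shift_out i ?k"] fg_factor_module
        fg_right_module L.inj_on_shift_in R.image_shift_out) simp_all
qed

text \<open>Both cut letters point into the middle piece. Dividing it out leaves two pieces that no
  letter joins, hence a direct sum.\<close>

lemma short_exact_inner_submodule:
  assumes an: "0 < a" "0 < n" "a + n < length xs"
    and dir: "snd (ls ! (a - 1))" "\<not> snd (ls ! (a + n - 1))"
  shows "short_exact (path_algebra Q Quot I) (factor_module xs ls a n) (string_module xs ls)
    (module_sum (factor_module xs ls 0 a) (factor_module xs ls (a + n) (length xs - (a + n))))"
    (is "short_exact ?R ?M' ?M (module_sum ?L ?N)")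
proof -
  let ?k = "length xs - (a + n)"
  let ?g = "\<lambda>m. (shift_out 0 a m, shift_out (a + n) ?k m)"
  interpret L: string_factor xs ls 0 a using an length_walk by unfold_locales auto
  interpret M: string_factor xs ls a n using an length_walk by unfold_locales auto
  interpret R: string_factor xs ls "a + n" ?k using an length_walk by unfold_locales auto
  have "shift_in a n \<in> right_module_hom ?R ?M' ?M"
    using dir by (intro M.shift_in_hom) auto
  moreover have "shift_out 0 a \<in> right_module_hom ?R ?M ?L" "shift_out (a + n) ?k \<in> right_module_hom ?R ?M ?N"
    using an dir by (auto intro!: L.shift_out_hom R.shift_out_hom)
  then have "?g \<in> right_module_hom ?R ?M (module_sum ?L ?N)"
    unfolding right_module_hom_def by (simp add: module_sum_simps)
  moreover have "\<not> (a \<le> j \<and> j < a + n) \<longleftrightarrow>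
      (0 \<le> j \<and> j < 0 + a) \<or> (a + n \<le> j \<and> j < a + n + ?k) \<or> length xs \<le> j" for j
    using an by auto
  then have "shift_in a n ` carrier ?M' = {m \<in> carrier ?M. ?g m = \<zero>\<^bsub>module_sum ?L ?N\<^esub>}"
    unfolding M.image_shift_in module_sum_simps L.factor_module_simps R.factor_module_simps
      prod.inject shift_out_eq_zero string_module_simps
    by blast
  moreover have "?g ` carrier ?M = carrier (module_sum ?L ?N)"
  proof (intro equalityI subsetI)
    fix p assume p: "p \<in> carrier (module_sum ?L ?N)"
    \<comment> \<open>A preimage is found by extending both components by zero; their intervals are
      disjoint, so the restrictions recover them.\<close>
    let ?m = "shift_in 0 a (fst p) \<oplus>\<^bsub>?M\<^esub> shift_in (a + n) ?k (snd p)"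
    have "?m \<in> carrier ?M"
      using L.shift_in_closed[of "fst p"] R.shift_in_closed[of "snd p"] by (simp add: string_module_simps)
    moreover have "p = ?g ?m"
      using p unfolding module_sum_simps string_module_simps(3)
      by (auto simp: shift_out_add L.shift_out_shift_in R.shift_out_shift_in shift_out_shift_in_disjoint)
    ultimately show "p \<in> ?g ` carrier ?M" by (intro image_eqI[of p ?g ?m])
  qed (auto simp: module_sum_simps L.factor_module_simps R.factor_module_simps shift_out_def)
  ultimately show ?thesis
    using an by (intro short_exactI[of _ _ _ _ "shift_in a n" ?g] fg_factor_module fg_right_module
        fg_right_module_module_sum M.inj_on_shift_in) simp_all
qed

text \<open>Both cut letters point out of the middle piece, so each outer piece is a submodule; they
  have disjoint supports and together span the kernel of the restriction to the middle.\<close>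

lemma short_exact_inner_quotient:
  assumes an: "0 < a" "0 < n" "a + n < length xs"
    and dir: "\<not> snd (ls ! (a - 1))" "snd (ls ! (a + n - 1))"
  shows "short_exact (path_algebra Q Quot I)
    (module_sum (factor_module xs ls 0 a) (factor_module xs ls (a + n) (length xs - (a + n))))
    (string_module xs ls) (factor_module xs ls a n)"
    (is "short_exact ?R (module_sum ?L ?N) ?M ?M''")
proof -
  let ?k = "length xs - (a + n)"
  let ?f = "\<lambda>p. shift_in 0 a (fst p) \<oplus>\<^bsub>?M\<^esub> shift_in (a + n) ?k (snd p)"
  interpret L: string_factor xs ls 0 a using an length_walk by unfold_locales auto
  interpret M: string_factor xs ls a n using an length_walk by unfold_locales auto
  interpret R: string_factor xs ls "a + n" ?k using an length_walk by unfold_locales auto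
  have "shift_out a n \<in> right_module_hom ?R ?M ?M''"
    using dir by (intro M.shift_out_hom) auto
  moreover have "shift_in 0 a \<in> right_module_hom ?R ?L ?M" "shift_in (a + n) ?k \<in> right_module_hom ?R ?N ?M"
    using an dir by (auto intro!: L.shift_in_hom R.shift_in_hom)
  then have "?f \<in> right_module_hom ?R (module_sum ?L ?N) ?M"
    unfolding right_module_hom_def
    by (auto simp: module_sum_simps string_module_simps string_act_add_right add_ac)
  \<comment> \<open>The pair of restrictions is a left inverse of \<open>?f\<close>.\<close>
  moreover have "(shift_out 0 a (?f p), shift_out (a + n) ?k (?f p)) = p"
    if "p \<in> carrier (module_sum ?L ?N)" for p
    using that unfolding module_sum_simps string_module_simps(3)
    by (auto simp: shift_out_add L.shift_out_shift_in R.shift_out_shift_in shift_out_shift_in_disjoint)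
  then have "inj_on ?f (carrier (module_sum ?L ?N))"
    by (intro inj_on_inverseI[of _ "\<lambda>m. (shift_out 0 a m, shift_out (a + n) ?k m)"])
  moreover have "?f ` carrier (module_sum ?L ?N) = {m \<in> carrier ?M. shift_out a n m = \<zero>\<^bsub>?M''\<^esub>}"
    (is "_ = ?K")
  proof (intro equalityI subsetI)
    fix m assume "m \<in> ?f ` carrier (module_sum ?L ?N)"
    then obtain p where "m = ?f p" by blast
    moreover have "shift_out a n (?f p) = (\<lambda>_. 0)"
      by (simp add: string_module_simps(3) shift_out_add shift_out_shift_in_disjoint)
    moreover have "?f p \<in> carrier ?M"
      using L.shift_in_closed[of "fst p"] R.shift_in_closed[of "snd p"] by (simp add: string_module_simps)
    ultimately show "m \<in> ?K" by (simp add: M.factor_module_simps)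
  next
    fix m assume m: "m \<in> ?K"
    then have zero: "\<forall>j\<ge>length xs. m j = 0" "\<forall>j. a \<le> j \<and> j < a + n \<longrightarrow> m j = 0"
      by (simp_all add: string_module_simps M.factor_module_simps shift_out_eq_zero)
    have "m = ?f (shift_out 0 a m, shift_out (a + n) ?k m)"
    proof
      fix j
      consider "j < a" | "a \<le> j \<and> j < a + n" | "a + n \<le> j" "j < length xs" | "length xs \<le> j"
        by linarith
      then show "m j = ?f (shift_out 0 a m, shift_out (a + n) ?k m) j"
        using zero an by cases (auto simp: string_module_simps(3) shift_in_def shift_out_def)
    qed
    moreover have "(shift_out 0 a m, shift_out (a + n) ?k m) \<in> carrier (module_sum ?L ?N)"
      by (simp add: module_sum_simps L.factor_module_simps R.factor_module_simps shift_out_def)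
    ultimately show "m \<in> ?f ` carrier (module_sum ?L ?N)" by (rule image_eqI)
  qed
  ultimately show ?thesis
    using an by (intro short_exactI[of _ _ _ _ ?f "shift_out a n"] fg_factor_module fg_right_module
        fg_right_module_module_sum M.image_shift_out) simp_all
qed

end

section \<open>Corners of polygons\<close>

lemma outer_sides_ge_gsides: "gsides P \<le> outer_sides P"
  by (simp add: outer_sides_def)

text \<open>Parameters in one half-open period give angles less than a full turn apart, where the
  exponential is injective.\<close>

lemma cis_poly_angle_inj:
  assumes "cis (poly_angle P s) = cis (poly_angle P t)"
    and "0 \<le> s" "s < outer_sides P" "0 \<le> t" "t < outer_sides P"
  shows "s = t"
proof -
  have o: "0 < real (outer_sides P)" using assms(2,3) by linarith
  have "poly_angle P s - poly_angle P t = 2 * pi * ((s - t) / outer_sides P)"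
    by (simp add: poly_angle_def diff_divide_distrib algebra_simps)
  then have "\<bar>poly_angle P s - poly_angle P t\<bar> = 2 * pi * (\<bar>s - t\<bar> / outer_sides P)"
    by (simp add: abs_mult)
  also have "\<bar>s - t\<bar> / outer_sides P < 1"
    using assms o by (simp add: field_simps abs_if)
  then have "2 * pi * (\<bar>s - t\<bar> / outer_sides P) < 2 * pi * 1"
    by (intro mult_strict_left_mono) simp_all
  finally have "\<bar>Im (\<i> * poly_angle P s) - Im (\<i> * poly_angle P t)\<bar> < 2 * pi" by simp
  moreover have "exp (\<i> * poly_angle P s) = exp (\<i> * poly_angle P t)"
    using assms(1) by (simp add: cis_conv_exp)
  ultimately have "\<i> * poly_angle P s = \<i> * poly_angle P t"
    by (rule exp_complex_eqI)
  then show ?thesis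
    using o by (simp add: poly_angle_def)
qed

lemma open_side_disjoint:
  assumes "z \<in> open_side P k" "z \<in> open_side P l" "k < outer_sides P" "l < outer_sides P"
  shows "k = l"
proof -
  obtain s where s: "z = cis (poly_angle P s)" "real k < s" "s < real k + 1"
    using assms(1) unfolding open_side_def by auto
  obtain t where t: "z = cis (poly_angle P t)" "real l < t" "t < real l + 1"
    using assms(2) unfolding open_side_def by auto
  note st = s t
  moreover have "real k + 1 \<le> outer_sides P" "real l + 1 \<le> outer_sides P"
    using assms(3,4) by linarith+
  ultimately have "s = t"
    by (intro cis_poly_angle_inj[of P]) auto
  with st show ?thesis by linarith
qed

text \<open>A corner of an annulus at its last side uses parameters beyond the first period. The
  bound admits exactly one wrap-around.\<close>

lemma cis_poly_angle_in_open_side: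
  assumes "real k < s" "s < real k + 1" "k < 2 * outer_sides P"
  shows "cis (poly_angle P s) \<in> open_side P (k mod outer_sides P)"
proof (cases "k < outer_sides P")
  case True
  with assms show ?thesis by (auto simp: open_side_def)
next
  case False
  then have k: "k mod outer_sides P = k - outer_sides P"
    using assms(3) by (simp add: mod_if)
  have o: "0 < outer_sides P" using assms(3) by simp
  have "cis (poly_angle P (s - outer_sides P)) = cis (poly_angle P s - 2 * pi)"
    using o by (simp add: poly_angle_def field_simps)
  also have "\<dots> = cis (poly_angle P s)"
    by (simp add: cis_divide[symmetric])
  finally show ?thesis
    unfolding open_side_def k using False assms(1,2)
    by (intro image_eqI[of _ _ "s - outer_sides P"]) (auto simp: of_nat_diff)
qed

text \<open>The far end of the last side is rewritten as the vertex 0, so that the index stays in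
  the range in which vertices are known to be marked points.\<close>

lemma side_cases:
  assumes "z \<in> side P k" "k < outer_sides P"
  obtains "z \<in> open_side P k" | l where "l < outer_sides P" "z = vertex P l"
proof -
  obtain s where s: "z = cis (poly_angle P s)" "real k \<le> s" "s \<le> real k + 1"
    using assms(1) unfolding side_def by auto
  consider "real k < s" "s < real k + 1" | "s = real k" | "s = real (Suc k)" "Suc k < outer_sides P"
    | "s = real (outer_sides P)"
    using s assms(2) by force
  then show thesis
  proof cases
    case 1
    with s that(1) show thesis by (auto simp: open_side_def)
  next
    case 2
    with s assms(2) that(2)[of k] show thesis by (simp add: vertex_def)
  next
    case 3
    with s that(2)[of "Suc k"] show thesis by (simp add: vertex_def)
  next
    case 4
    have "poly_angle P (outer_sides P) = 2 * pi" "poly_angle P 0 = 0"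
      using assms(2) by (auto simp: poly_angle_def)
    with 4 s assms(2) that(2)[of 0] show thesis by (simp add: vertex_def)
  qed
qed

text \<open>Reduction modulo the number of sides matters for an annulus, where the last side is
  followed by the side 0; only reduced indices can be compared through
  \<open>open_side_disjoint\<close>.\<close>

definition entry_side :: "'a polygon \<Rightarrow> nat \<Rightarrow> bool \<Rightarrow> nat" where
  "entry_side P k left = (if left then Suc k mod outer_sides P else k)"

definition exit_side :: "'a polygon \<Rightarrow> nat \<Rightarrow> bool \<Rightarrow> nat" where
  "exit_side P k left = (if left then k else Suc k mod outer_sides P)"

lemma corner_sides:
  assumes "is_corner P k"
  shows "entry_side P k left < gsides P" "exit_side P k left < gsides P"
  using assms by (auto simp: entry_side_def exit_side_def is_corner_def outer_sides_def)

text \<open>Parameters increase counterclockwise on the unit circle, so rising arcs wind positively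
  around the origin and their reversals negatively.\<close>

lemma winding_number_poly_arc_pos:
  assumes "s < t" "0 < outer_sides P"
  shows "0 < Re (winding_number (poly_arc P s t) 0)" "Re (winding_number (poly_arc P t s) 0) < 0"
proof -
  have "poly_angle P s < poly_angle P t"
    using assms by (simp add: poly_angle_def field_simps)
  then show pos: "0 < Re (winding_number (poly_arc P s t) 0)"
    unfolding poly_arc_def by (intro winding_number_part_circlepath_pos_less) simp_all
  have "0 \<notin> path_image (poly_arc P s t)"
    unfolding poly_arc_def using path_image_part_circlepath_subset'[of 1 0] by force
  then have "winding_number (reversepath (poly_arc P s t)) 0 = - winding_number (poly_arc P s t) 0"
    by (intro winding_number_reversepath) (simp_all add: poly_arc_def)
  moreover have "reversepath (poly_arc P s t) = poly_arc P t s"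
    unfolding poly_arc_def by (rule reversepath_part_circlepath)
  ultimately show "Re (winding_number (poly_arc P t s) 0) < 0"
    using pos by simp
qed

lemma winding_number_poly_arc_join:
  "winding_number (poly_arc P s t +++ poly_arc P t u) 0 =
     winding_number (poly_arc P s t) 0 + winding_number (poly_arc P t u) 0"
proof -
  have "0 \<notin> path_image (poly_arc P s t)" for s t
    unfolding poly_arc_def using path_image_part_circlepath_subset'[of 1 0] by force
  then show ?thesis
    by (intro winding_number_join) (simp_all add: poly_arc_def)
qed

lemma poly_arc_ends:
  "pathstart (poly_arc P s t) = cis (poly_angle P s)" "pathfinish (poly_arc P s t) = cis (poly_angle P t)"
  by (simp_all add: poly_arc_def cis_conv_exp)

text \<open>In an annulus with one or two sides the same pair of sides can be joined around two
  corners; the sign of the winding number around the hole tells on which side the corner lies.\<close>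

lemma crosses_cornerE:
  assumes "crosses_corner S \<sigma> P k left"
  obtains z where "P \<in> polys S" "is_corner P k" "lifts_to P \<sigma> z"
    "z 0 \<in> open_side P (entry_side P k left)" "z 1 \<in> open_side P (exit_side P k left)"
    "hole P \<Longrightarrow> if left then Re (winding_number z 0) < 0 else 0 < Re (winding_number z 0)"
proof -
  obtain z \<alpha> \<beta> where P: "P \<in> polys S" "is_corner P k" and z: "lifts_to P \<sigma> z"
    and \<alpha>: "real k < \<alpha>" "\<alpha> < real k + 1" and \<beta>: "real k + 1 < \<beta>" "\<beta> < real k + 2"
    and hom: "homotopic_paths (poly_dom P) z
          (if left then poly_arc P \<beta> (real k + 1) +++ poly_arc P (real k + 1) \<alpha>
           else poly_arc P \<alpha> (real k + 1) +++ poly_arc P (real k + 1) \<beta>)"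
    using assms unfolding crosses_corner_def by blast
  have k: "k < outer_sides P" 
    using P(2) outer_sides_ge_gsides[of P] by (auto simp: is_corner_def)
  have \<alpha>': "cis (poly_angle P \<alpha>) \<in> open_side P k"
    using cis_poly_angle_in_open_side[of k \<alpha> P] \<alpha> k by simp
  have \<beta>': "cis (poly_angle P \<beta>) \<in> open_side P (Suc k mod outer_sides P)"
    using \<beta> k by (intro cis_poly_angle_in_open_side) auto
  have "pathstart z = cis (poly_angle P (if left then \<beta> else \<alpha>))"
      "pathfinish z = cis (poly_angle P (if left then \<alpha> else \<beta>))"
    using homotopic_paths_imp_pathstart[OF hom] homotopic_paths_imp_pathfinish[OF hom]
    by (auto simp: poly_arc_ends)
  with \<alpha>' \<beta>' have ends: "z 0 \<in> open_side P (entry_side P k left)" "z 1 \<in> open_side P (exit_side P k left)"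
    by (auto simp: pathstart_def pathfinish_def entry_side_def exit_side_def)
  have "if left then Re (winding_number z 0) < 0 else 0 < Re (winding_number z 0)" if "hole P"
  proof -
    \<comment> \<open>The origin lies in the hole, so a homotopy inside the annulus preserves the
      winding number around it.\<close>
    have "poly_dom P \<subseteq> - {0}" using that by (auto simp: poly_dom_def)
    from winding_number_homotopic_paths[OF homotopic_paths_subset[OF hom this]] show ?thesis
      using winding_number_poly_arc_pos[of \<alpha> "real k + 1" P] winding_number_poly_arc_pos[of "real k + 1" \<beta> P]
        \<alpha> \<beta> k
      by (cases left) (auto simp: winding_number_poly_arc_join)
  qed
  with P z ends show thesis by (rule that)
qed

section \<open>Reparametrised segments and their corners\<close>

lemma runs_along_sym:
  assumes "runs_along \<sigma>' \<sigma>"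
  shows "runs_along \<sigma> \<sigma>'"
proof -
  obtain h where h: "continuous_on {0..1} h" "strict_mono_on {0..1} h" "h 0 = 0" "h 1 = (1::real)"
    and eq: "\<forall>s\<in>{0..1}. \<sigma>' s = \<sigma> (h s)"
    using assms unfolding runs_along_def by blast
  let ?g = "inv_into {0..1} h"
  have inj: "inj_on h {0..1}" using h(2) by (rule strict_mono_on_imp_inj_on)
  have "h ` {0..1} \<subseteq> {0..1}"
  proof clarify
    fix s :: real assume s: "s \<in> {0..1}"
    have "mono_on {0..1} h" using h(2) by (rule strict_mono_on_imp_mono_on)
    then have "h 0 \<le> h s" "h s \<le> h 1" using s by (auto simp: mono_on_def)
    with h(3,4) show "h s \<in> {0..1}" by simp
  qed
  moreover have "{0..1} \<subseteq> h ` {0..1}"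
    using IVT'[of h 0 _ 1] h by (force simp: subset_iff)
  ultimately have img: "h ` {0..1} = {0..1}" by blast
  have g: "?g t \<in> {0..1}" "h (?g t) = t" if "t \<in> {0..1}" for t
    using that img by (metis inv_into_into, metis f_inv_into_f)
  have "continuous_on (h ` {0..1}) ?g"
    using h(1) inj by (intro continuous_on_inv) (auto simp: inv_into_f_f)
  moreover have "strict_mono_on {0..1} ?g"
  proof (rule strict_mono_onI)
    fix s t :: real assume st: "s \<in> {0..1}" "t \<in> {0..1}" "s < t"
    show "?g s < ?g t"
    proof (rule ccontr)
      assume "\<not> ?g s < ?g t"
      then have "h (?g t) \<le> h (?g s)"
        using h(2) g st by (intro mono_onD[OF strict_mono_on_imp_mono_on[OF h(2)]]) auto
      with g(2) st show False by simp
    qed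
  qed
  moreover have "?g 0 = 0" "?g 1 = 1"
    using inv_into_f_f[OF inj, of 0] inv_into_f_f[OF inj, of 1] h(3,4) by auto
  moreover have "\<forall>t\<in>{0..1}. \<sigma> t = \<sigma>' (?g t)"
    using eq g by metis
  ultimately show ?thesis unfolding runs_along_def img by blast
qed

text \<open>A reparametrised lift is homotopic to the lift within the polygon, so the boundary path
  around the corner and its parameters can be kept.\<close>

lemma crosses_corner_runs_along:
  assumes "runs_along \<sigma>' \<sigma>" "crosses_corner S \<sigma> P k left"
  shows "crosses_corner S \<sigma>' P k left"
proof -
  obtain h where h: "continuous_on {0..1} h" "strict_mono_on {0..1} h" "h 0 = 0" "h 1 = (1::real)"
    and eq: "\<forall>s\<in>{0..1}. \<sigma>' s = \<sigma> (h s)"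
    using assms(1) unfolding runs_along_def by blast
  have h01: "h \<in> {0..1} \<rightarrow> {0..1}"
  proof
    fix s :: real assume s: "s \<in> {0..1}"
    have "mono_on {0..1} h" using h(2) by (rule strict_mono_on_imp_mono_on)
    then have "h 0 \<le> h s" "h s \<le> h 1" using s by (auto simp: mono_on_def)
    with h(3,4) show "h s \<in> {0..1}" by simp
  qed
  obtain z \<alpha> \<beta> where P: "P \<in> polys S" "is_corner P k" and z: "lifts_to P \<sigma> z"
    and \<alpha>\<beta>: "real k < \<alpha>" "\<alpha> < real k + 1" "real k + 1 < \<beta>" "\<beta> < real k + 2"
    and hom: "homotopic_paths (poly_dom P) z
          (if left then poly_arc P \<beta> (real k + 1) +++ poly_arc P (real k + 1) \<alpha>
           else poly_arc P \<alpha> (real k + 1) +++ poly_arc P (real k + 1) \<beta>)"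
    using assms(2) unfolding crosses_corner_def by blast
  have hom': "homotopic_paths (poly_dom P) z (z \<circ> h)"
    using z h h01 unfolding lifts_to_def
    by (intro homotopic_paths_reparametrize[where f = h]) auto
  then have "path (z \<circ> h)" "path_image (z \<circ> h) \<subseteq> poly_dom P"
    using homotopic_paths_imp_path homotopic_paths_imp_subset by blast+
  then have "lifts_to P \<sigma>' (z \<circ> h)"
    using z eq h01 unfolding lifts_to_def by (auto simp: Pi_iff)
  moreover note homotopic_paths_trans[OF homotopic_paths_sym[OF hom'] hom]
  ultimately show ?thesis
    unfolding crosses_corner_def using P \<alpha>\<beta> by blast
qed

text \<open>By symmetry of \<open>runs_along\<close> both segments cross the same corners, so the
  two definite descriptions have equivalent predicates.\<close>

lemma corner_at_runs_along:
  assumes "runs_along (segment S d i) (segment S c j)"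
  shows "corner_at S d i = corner_at S c j"
  unfolding corner_at_def
  using crosses_corner_runs_along[OF assms] crosses_corner_runs_along[OF runs_along_sym[OF assms]]
  by metis

section \<open>Curves in marked ribbon surfaces\<close>

lemma side_arc_mod: "side_arc S P (k mod outer_sides P) = side_arc S P k"
  by (simp add: side_arc_def)

locale marked_surface =
  fixes S :: "'a ribbon_surface"
  assumes surface: "marked_ribbon_surface S"
begin

lemma curves_disjoint:
  "\<lbrakk>\<gamma> \<in> curves S; \<delta> \<in> curves S; x \<in> \<gamma> ` {0<..<1}; x \<in> \<delta> ` {0<..<1}\<rbrakk> \<Longrightarrow> \<gamma> = \<delta>"
  using surface unfolding marked_ribbon_surface_def by blast

lemma elementary: "P \<in> polys S \<Longrightarrow> elementary_polygon S P"
  using surface unfolding marked_ribbon_surface_def by blast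

lemma open_side_bij:
  assumes "P \<in> polys S" "k < gsides P"
  obtains \<gamma> where "\<gamma> \<in> curves S" "bij_betw (chart P) (open_side P k) (\<gamma> ` {0<..<1})"
  using elementary[OF assms(1)] assms(2) unfolding elementary_polygon_def by blast

lemma side_arc_eqI:
  assumes "\<gamma> \<in> curves S" "chart P ` open_side P (k mod outer_sides P) = \<gamma> ` {0<..<1}"
  shows "side_arc S P k = \<gamma>"
  unfolding side_arc_def
proof (rule the_equality)
  fix \<delta> assume "\<delta> \<in> curves S \<and> chart P ` open_side P (k mod outer_sides P) = \<delta> ` {0<..<1}"
  \<comment> \<open>A common interior point suffices, since interiors of different arcs are
    disjoint.\<close>
  moreover have "\<gamma> (1/2) \<in> \<gamma> ` {0<..<1}" by simp
  ultimately show "\<delta> = \<gamma>" using assms curves_disjoint by metis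
qed (use assms in simp)

lemma side_arc:
  assumes "P \<in> polys S" "k < gsides P"
  shows "side_arc S P k \<in> curves S"
    and "chart P ` open_side P k = side_arc S P k ` {0<..<1}"
    and "inj_on (chart P) (open_side P k)"
proof -
  obtain \<gamma> where \<gamma>: "\<gamma> \<in> curves S" "bij_betw (chart P) (open_side P k) (\<gamma> ` {0<..<1})"
    using assms by (rule open_side_bij)
  have "k < outer_sides P" using assms(2) outer_sides_ge_gsides[of P] by linarith
  with \<gamma> have eq: "side_arc S P k = \<gamma>"
    by (intro side_arc_eqI) (auto simp: bij_betw_def)
  show "side_arc S P k \<in> curves S" "chart P ` open_side P k = side_arc S P k ` {0<..<1}"
    "inj_on (chart P) (open_side P k)"
    using \<gamma> unfolding eq bij_betw_def by auto
qed

lemma side_arc_corner: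
  assumes "P \<in> polys S" "is_corner P k"
  shows "side_arc S P k \<in> curves S" "side_arc S P (k + 1) \<in> curves S"
proof -
  show "side_arc S P k \<in> curves S"
    using side_arc(1)[OF assms(1) corner_sides(2)[OF assms(2), of True]] by (simp add: exit_side_def)
  show "side_arc S P (k + 1) \<in> curves S"
    using side_arc(1)[OF assms(1) corner_sides(1)[OF assms(2), of True]]
    by (simp add: entry_side_def side_arc_mod)
qed

text \<open>An open side in \<Gamma> is mapped into an arc and a vertex to a marked point, which
  lies on the boundary; a point off arcs and boundary can lift to neither.\<close>

lemma lift_in_face_dom:
  assumes P: "P \<in> polys S" and z: "lifts_to P \<sigma> z"
    and s: "s \<in> {0..1}" "\<sigma> s \<notin> arcs_union S" "\<sigma> s \<notin> bdry S"
  shows "z s \<in> face_dom P"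
proof -
  have "z s \<notin> side P k" if k: "k < gsides P" for k
  proof
    assume "z s \<in> side P k"
    moreover have "k < outer_sides P" using k outer_sides_ge_gsides[of P] by linarith
    ultimately show False
    proof (cases rule: side_cases)
      case 1
      then have "\<sigma> s \<in> side_arc S P k ` {0<..<1}"
        using side_arc(2)[OF P k] z s(1) unfolding lifts_to_def by (metis imageI)
      with side_arc(1)[OF P k] s(2) show False by (auto simp: arcs_union_def)
    next
      case (2 l)
      then have "chart P (z s) \<in> marked S"
        using elementary[OF P] by (simp add: elementary_polygon_def)
      moreover have "marked S \<subseteq> bdry S"
        using surface by (simp add: marked_ribbon_surface_def)
      ultimately show False
        using z s unfolding lifts_to_def by auto
    qed
  qed
  moreover have "z s \<in> poly_dom P"
    using z s(1) by (auto simp: lifts_to_def path_image_def)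
  ultimately show ?thesis by (simp add: face_dom_def)
qed

text \<open>The midpoint of the segment determines the face and thereby the polygon. The chart is
  injective on \<open>face_dom\<close>, which settles the open interval; at the ends, where the
  chart may identify points, the lifts agree by continuity.\<close>

lemma lift_unique:
  assumes P: "P \<in> polys S" "lifts_to P \<sigma> z" and P': "P' \<in> polys S" "lifts_to P' \<sigma> z'"
    and \<sigma>: "\<And>s. s \<in> {0<..<1} \<Longrightarrow> \<sigma> s \<notin> arcs_union S" "\<And>s. s \<in> {0<..<1} \<Longrightarrow> \<sigma> s \<notin> bdry S"
  shows "P = P' \<and> (\<forall>s\<in>{0..1}. z s = z' s)"
proof -
  have dom: "z s \<in> face_dom P" "z' s \<in> face_dom P'" if "s \<in> {0<..<1}" for s
    using lift_in_face_dom[OF P, of s] lift_in_face_dom[OF P', of s] \<sigma>[OF that] that by auto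
  have eq: "chart P (z s) = chart P' (z' s)" if "s \<in> {0..1}" for s
    using P P' that by (simp add: lifts_to_def)
  have faces: "bij_betw face (polys S)
      (connected_components_of (subtopology (surf S) (topspace (surf S) - arcs_union S)))"
    using surface by (simp add: marked_ribbon_surface_def)
  have "chart P (z (1/2)) \<in> face P" "chart P' (z' (1/2)) \<in> face P'"
    using dom[of "1/2"] by (simp_all add: face_def)
  then have "chart P (z (1/2)) \<in> face P \<inter> face P'"
    using eq[of "1/2"] by simp
  then have "face P = face P'"
    using P(1) P'(1) faces
      connected_components_of_overlap[of "face P" "subtopology (surf S) (topspace (surf S) - arcs_union S)" "face P'"]
    by (auto simp: bij_betw_def)
  with P(1) P'(1) faces have PP: "P = P'"
    by (auto simp: bij_betw_def dest: inj_onD)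
  have "homeomorphic_map (top_of_set (face_dom P)) (subtopology (surf S) (face P)) (chart P)"
    using elementary[OF P(1)] by (simp add: elementary_polygon_def)
  then have "inj_on (chart P) (face_dom P)"
    using homeomorphic_imp_injective_map by fastforce
  then have zero: "z s - z' s = 0" if "s \<in> {0<..<1}" for s
    using that dom[OF that] eq[of s] PP by (auto dest: inj_onD)
  have "continuous_on {0..1} (\<lambda>s. z s - z' s)"
    using P(2) P'(2) unfolding lifts_to_def path_def by (blast intro: continuous_on_diff)
  then have "continuous_on (closure {0<..<1}) (\<lambda>s. z s - z' s)"
    by simp
  from continuous_constant_on_closure[OF this zero]
  have "z s - z' s = 0" if "s \<in> {0..1}" for s
    using that by simp
  with PP show ?thesis by simp
qed

lemma crosses_corner_unique:
  assumes "crosses_corner S \<sigma> P k left" "crosses_corner S \<sigma> P' k' left'"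
    and "\<And>s. s \<in> {0<..<1} \<Longrightarrow> \<sigma> s \<notin> arcs_union S" "\<And>s. s \<in> {0<..<1} \<Longrightarrow> \<sigma> s \<notin> bdry S"
  shows "P = P' \<and> k = k' \<and> left = left'"
proof -
  obtain z where z: "P \<in> polys S" "is_corner P k" "lifts_to P \<sigma> z"
    "z 0 \<in> open_side P (entry_side P k left)" "z 1 \<in> open_side P (exit_side P k left)"
    "hole P \<Longrightarrow> if left then Re (winding_number z 0) < 0 else 0 < Re (winding_number z 0)"
    using crosses_cornerE[OF assms(1)] by blast
  obtain z' where z': "P' \<in> polys S" "is_corner P' k'" "lifts_to P' \<sigma> z'"
    "z' 0 \<in> open_side P' (entry_side P' k' left')" "z' 1 \<in> open_side P' (exit_side P' k' left')"
    "hole P' \<Longrightarrow> if left' then Re (winding_number z' 0) < 0 else 0 < Re (winding_number z' 0)"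
    using crosses_cornerE[OF assms(2)] by blast
  have P: "P' = P" and zz': "\<And>s. s \<in> {0..1} \<Longrightarrow> z' s = z s"
    using lift_unique[OF z(1,3) z'(1,3) assms(3,4)] by auto
  note z' = z'[unfolded P]
  note sides = corner_sides[OF z(2), of left] corner_sides[OF z'(2), of left'] outer_sides_ge_gsides[of P]
  have entry: "entry_side P k left = entry_side P k' left'"
    using z(4) z'(4) zz'[of 0] sides by (intro open_side_disjoint[of "z 0" P]) auto
  have exit: "exit_side P k left = exit_side P k' left'"
    using z(5) z'(5) zz'[of 1] sides by (intro open_side_disjoint[of "z 1" P]) auto
  \<comment> \<open>In an annulus the sign of the winding number decides. In a disc the two sides of
    a corner have indices \<open>k\<close> and \<open>k + 1\<close> without wrap-around, so their
    order shows the direction.\<close>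
  have left: "left = left'"
  proof (cases "hole P")
    case True
    have "winding_number z' 0 = winding_number z 0"
      using zz' by (intro winding_number_cong) auto
    with z(6)[OF True] z'(6)[OF True] show ?thesis by (auto split: if_splits)
  next
    case False
    then have "Suc k < outer_sides P" "Suc k' < outer_sides P"
      using z(2) z'(2) by (auto simp: is_corner_def outer_sides_def)
    with entry exit show ?thesis by (auto simp: entry_side_def exit_side_def split: if_splits)
  qed
  with entry exit P show ?thesis
    by (cases left) (auto simp: entry_side_def exit_side_def)
qed

end

section \<open>Cut times, crossed arcs and corners of a single curve\<close>

lemma strict_sorted_cuts:
  fixes X :: "real set"
  assumes "finite X" "X \<subseteq> {0<..<1}"
  shows "sorted_wrt (<) (0 # sorted_list_of_set X @ [1])"
  using assms by (auto simp: sorted_wrt_append)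

locale surface_curve = marked_surface +
  fixes c :: "real \<Rightarrow> 'a"
  assumes curve: "curve_in S c" and position: "general_position S c"
begin

lemma finite_crossing_times: "finite (crossing_times S c)"
  using position by (simp add: general_position_def)

lemma off_boundary: "t \<in> {0<..<1} \<Longrightarrow> c t \<notin> bdry S"
  using curve by (auto simp: curve_in_def image_subset_iff)

abbreviation "cuts \<equiv> 0 # sorted_list_of_set (crossing_times S c) @ [1]"

lemma crossing_times_subset: "crossing_times S c \<subseteq> {0<..<1}"
  by (auto simp: crossing_times_def)

lemma length_cuts: "length cuts = segments S c + 1"
  using finite_crossing_times by (simp add: segments_def)

lemma cut_time_less: "i < j \<Longrightarrow> j \<le> segments S c \<Longrightarrow> cut_time S c i < cut_time S c j"
  using strict_sorted_cuts[OF finite_crossing_times crossing_times_subset] length_cuts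
  unfolding cut_time_def by (metis Suc_eq_plus1 less_Suc_eq_le sorted_wrt_nth_less)

lemma cut_time_0: "cut_time S c 0 = 0" and cut_time_segments: "cut_time S c (segments S c) = 1"
  using finite_crossing_times by (simp_all add: cut_time_def segments_def nth_append)

lemma cut_time_crossing:
  assumes "1 \<le> j" "j < segments S c"
  shows "cut_time S c j \<in> crossing_times S c"
proof -
  have "cut_time S c j = sorted_list_of_set (crossing_times S c) ! (j - 1)"
    using assms finite_crossing_times by (auto simp: cut_time_def segments_def nth_append nth_Cons')
  also have "\<dots> \<in> set (sorted_list_of_set (crossing_times S c))"
    using assms finite_crossing_times by (intro nth_mem) (simp add: segments_def)
  finally show ?thesis using finite_crossing_times by simp
qed

lemma between_cut_times:
  assumes "1 \<le> j" "j \<le> segments S c" "cut_time S c (j - 1) < t" "t < cut_time S c j"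
  shows "t \<in> {0<..<1} - crossing_times S c"
proof -
  have le: "cut_time S c i \<le> cut_time S c k" if "i \<le> k" "k \<le> segments S c" for i k
    using cut_time_less[of i k] that by (cases "i = k") auto
  have "0 \<le> cut_time S c (j - 1)" "cut_time S c j \<le> 1"
    using le[of 0 "j - 1"] le[of j "segments S c"] assms(1,2) cut_time_0 cut_time_segments by auto
  moreover have "t \<notin> crossing_times S c"
  proof
    assume "t \<in> crossing_times S c"
    then have "t \<in> set cuts" using finite_crossing_times by simp
    then obtain i where i: "i < length cuts" "cuts ! i = t" by (metis in_set_conv_nth)
    then have "t = cut_time S c i" "i \<le> segments S c"
      using length_cuts by (simp_all add: cut_time_def)
    moreover have "i \<le> j - 1 \<or> j \<le> i" by linarith
    ultimately show False using assms le[of i "j - 1"] le[of j i] by force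
  qed
  ultimately show ?thesis using assms(3,4) by auto
qed

lemma segment_inside:
  assumes "1 \<le> j" "j \<le> segments S c" "s \<in> {0<..<1}"
  shows "segment S c j s \<notin> arcs_union S" "segment S c j s \<notin> bdry S"
proof -
  let ?a = "cut_time S c (j - 1)" and ?b = "cut_time S c j"
  have "?a < ?b" using cut_time_less[of "j - 1" j] assms by simp
  then have "0 < (?b - ?a) * s" "(?b - ?a) * s < (?b - ?a) * 1"
    using assms(3) by (simp_all del: mult_1_right)
  then have "?a + (?b - ?a) * s \<in> {0<..<1} - crossing_times S c"
    using assms(1,2) by (intro between_cut_times[of j]) auto
  then show "segment S c j s \<notin> arcs_union S" "segment S c j s \<notin> bdry S"
    using off_boundary by (simp_all add: segment_def crossing_times_def)
qed

lemma segment_ends: "segment S c j 0 = c (cut_time S c (j - 1))" "segment S c j 1 = c (cut_time S c j)"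
  by (simp_all add: segment_def)

lemma crossed_arc_unique:
  assumes "\<gamma> \<in> curves S" "c (cut_time S c j) \<in> \<gamma> ` {0<..<1}"
  shows "crossed_arc S c j = \<gamma>"
  unfolding crossed_arc_def using assms by (intro the_equality) (auto dest: curves_disjoint)

text \<open>A crossing point lies on some closed arc. It is not an end of this arc, since the ends
  lie on the boundary, which the curve avoids between its own end points.\<close>

lemma crossed_arc_in_curves:
  assumes "1 \<le> j" "j < segments S c"
  shows "crossed_arc S c j \<in> curves S"
proof -
  have t: "cut_time S c j \<in> {0<..<1}" "c (cut_time S c j) \<in> arcs_union S"
    using cut_time_crossing[OF assms] by (auto simp: crossing_times_def)
  then obtain \<gamma> s where \<gamma>: "\<gamma> \<in> curves S" "s \<in> {0..1}" "c (cut_time S c j) = \<gamma> s"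
    by (auto simp: arcs_union_def)
  have "c (cut_time S c j) \<notin> bdry S"
    using t(1) by (rule off_boundary)
  moreover have "\<gamma> 0 \<in> bdry S" "\<gamma> 1 \<in> bdry S"
    using surface \<gamma>(1) by (auto simp: marked_ribbon_surface_def)
  ultimately have "s \<noteq> 0" "s \<noteq> 1" using \<gamma>(3) by auto
  then have "c (cut_time S c j) \<in> \<gamma> ` {0<..<1}" using \<gamma>(2,3) by auto
  with \<gamma>(1) show ?thesis using crossed_arc_unique by simp
qed

lemma crossed_arc_eq_side_arc:
  assumes "P \<in> polys S" "k < gsides P" "c (cut_time S c j) \<in> chart P ` open_side P k"
  shows "crossed_arc S c j = side_arc S P k"
  using assms(3) side_arc(1,2)[OF assms(1,2)] by (intro crossed_arc_unique) auto

lemma corner_at_unique: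
  assumes "1 \<le> j" "j \<le> segments S c" "crosses_corner S (segment S c j) P k left"
  shows "corner_at S c j = ((P, k), left)"
  unfolding corner_at_def
proof (rule the_equality)
  fix x assume "crosses_corner S (segment S c j) (fst (fst x)) (snd (fst x)) (snd x)"
  then have "fst (fst x) = P \<and> snd (fst x) = k \<and> snd x = left"
    using assms(3) by (rule crosses_corner_unique) (use segment_inside[OF assms(1,2)] in blast)+
  then show "x = ((P, k), left)" by (auto simp: prod_eq_iff)
qed (use assms(3) in simp)

text \<open>The lift runs from the open entry side to the open exit side, and the chart maps these
  onto the interiors of the corresponding arcs.\<close>

lemma crossed_arcs_at_corner:
  assumes "2 \<le> j" "j < segments S c" "crosses_corner S (segment S c j) P k left"
  shows "crossed_arc S c j = side_arc S P (if left then k else k + 1)"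
    and "crossed_arc S c (j - 1) = side_arc S P (if left then k + 1 else k)"
proof -
  obtain z where z: "P \<in> polys S" "is_corner P k" "lifts_to P (segment S c j) z"
    "z 0 \<in> open_side P (entry_side P k left)" "z 1 \<in> open_side P (exit_side P k left)"
    using crosses_cornerE[OF assms(3)] by blast
  have "c (cut_time S c j) = chart P (z 1)" "c (cut_time S c (j - 1)) = chart P (z 0)"
    using z(3) by (auto simp: lifts_to_def segment_ends)
  then have "crossed_arc S c j = side_arc S P (exit_side P k left)"
      "crossed_arc S c (j - 1) = side_arc S P (entry_side P k left)"
    using z(4,5) crossed_arc_eq_side_arc[OF z(1) corner_sides(2)[OF z(2)]]
      crossed_arc_eq_side_arc[OF z(1) corner_sides(1)[OF z(2)]]
    by auto
  then show "crossed_arc S c j = side_arc S P (if left then k else k + 1)"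
    "crossed_arc S c (j - 1) = side_arc S P (if left then k + 1 else k)"
    by (auto simp: entry_side_def exit_side_def side_arc_mod)
qed

text \<open>By general position the curve never leaves an arc through the side of the polygon by which
  it has reached it, so consecutive corners do not compose to a relation.\<close>

lemma consecutive_corners:
  assumes "1 \<le> j" "j + 1 < segments S c"
    and "crosses_corner S (segment S c j) P k left" "crosses_corner S (segment S c (j + 1)) P k' left'"
  shows "exit_side P k left \<noteq> entry_side P k' left'"
proof
  assume eq: "exit_side P k left = entry_side P k' left'"
  obtain z where z: "P \<in> polys S" "is_corner P k" "lifts_to P (segment S c j) z"
    "z 1 \<in> open_side P (exit_side P k left)"
    using crosses_cornerE[OF assms(3)] by blast
  obtain z' where z': "lifts_to P (segment S c (j + 1)) z'"
    "z' 0 \<in> open_side P (entry_side P k' left')"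
    using crosses_cornerE[OF assms(4)] by blast
  have "chart P (z 1) = chart P (z' 0)"
    using z(3) z'(1) segment_ends(1)[of "j + 1"] segment_ends(2)[of j] by (auto simp: lifts_to_def)
  \<comment> \<open>The chart may identify different sides, but it is injective on each open
    side.\<close>
  then have "z 1 = z' 0"
    using side_arc(3)[OF z(1) corner_sides(2)[OF z(2), of left]] z(4) z'(2) eq by (auto dest: inj_onD)
  moreover have "z 1 \<noteq> z' 0"
    using position z(1,3) z'(1) assms(1,2)
    unfolding general_position_def by (metis add_lessD1 atLeastLessThan_iff)
  ultimately show False by simp
qed

end

section \<open>The string of a curve\<close>

text \<open>The relations without their start vertices, in the order of traversal: the arrow into
  side \<open>k + 1\<close>, then the arrow out of it to side \<open>k\<close>.\<close>

definition relation_pairs :: "'a ribbon_surface \<Rightarrow> (('a polygon \<times> nat) \<times> ('a polygon \<times> nat)) set" where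
  "relation_pairs S = {((P, Suc k mod outer_sides P), (P, k)) | P k.
     P \<in> polys S \<and> is_corner P k \<and> is_corner P (Suc k mod outer_sides P)}"

section \<open>Transport of quiver and relations between \<open>Q\<close> and the surface\<close>

locale ribbon_presentation = marked_surface S
  for Q :: "('v, 'e) pre_digraph" and I :: "(('v, 'e) qpath \<Rightarrow> 'k::field) set"
    and nv :: "'v \<Rightarrow> real \<Rightarrow> 'a" and na :: "'e \<Rightarrow> 'a polygon \<times> nat" and S :: "'a ribbon_surface" +
  assumes Q: "fin_digraph Q" and I: "ideal I (path_algebra Q)"
    and nv: "bij_betw nv (verts Q) (verts (ribbon_quiver S))"
    and na: "bij_betw na (arcs Q) (arcs (ribbon_quiver S))"
    and incidence: "\<And>a. a \<in> arcs Q \<Longrightarrow> tail (ribbon_quiver S) (na a) = nv (tail Q a) \<and>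
                 head (ribbon_quiver S) (na a) = nv (head Q a)"
    and I_eq: "I = (\<lambda>f (u, es). if (u, es) \<in> qpaths Q then f (nv u, map na es) else 0) ` ribbon_ideal S"
begin

lemma wf_ribbon_quiver: "wf_digraph (ribbon_quiver S)"
proof
  fix e assume "e \<in> arcs (ribbon_quiver S)"
  then show "tail (ribbon_quiver S) e \<in> verts (ribbon_quiver S)"
    "head (ribbon_quiver S) e \<in> verts (ribbon_quiver S)"
    using side_arc_corner by (auto simp: ribbon_quiver_def)
qed

lemma finite_verts_ribbon_quiver: "finite (verts (ribbon_quiver S))"
  using nv Q by (simp add: bij_betw_finite[symmetric] fin_digraph_def fin_digraph_axioms_def)

lemma ribbon_relations_qpaths: "ribbon_relations S \<subseteq> qpaths (ribbon_quiver S)"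
proof
  interpret wf_digraph "ribbon_quiver S" by (rule wf_ribbon_quiver)
  fix w assume "w \<in> ribbon_relations S"
  then obtain P k where w: "w = (side_arc S P (k + 2), [(P, (k + 1) mod outer_sides P), (P, k)])"
    and P: "P \<in> polys S" "is_corner P k" "is_corner P ((k + 1) mod outer_sides P)"
    unfolding ribbon_relations_def by blast
  \<comment> \<open>In an annulus the first arrow may sit at a corner whose index has wrapped
    around; its source is still the side \<open>k + 2\<close> modulo the number of sides.\<close>
  have "side_arc S P ((k + 1) mod outer_sides P + 1) = side_arc S P (k + 2)"
    using side_arc_mod[of S P "(k + 1) mod outer_sides P + 1"] side_arc_mod[of S P "k + 2"]
    by (simp add: mod_Suc_eq)
  moreover have "side_arc S P ((k + 1) mod outer_sides P) = side_arc S P (k + 1)"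
    by (rule side_arc_mod)
  moreover have "(P, k) \<in> arcs (ribbon_quiver S)" "(P, (k + 1) mod outer_sides P) \<in> arcs (ribbon_quiver S)"
    using P by (simp_all add: ribbon_quiver_def)
  moreover have "side_arc S P (k + 2) \<in> curves S"
    using side_arc_corner(2)[OF P(1,3)] calculation(1) by simp
  ultimately have "awalk (side_arc S P (k + 2)) [(P, (k + 1) mod outer_sides P), (P, k)] (side_arc S P k)"
    unfolding awalk_def by (simp add: cas_simp) (simp add: ribbon_quiver_def)
  then show "w \<in> qpaths (ribbon_quiver S)"
    unfolding w qpaths_def by blast
qed

definition pairs :: "('e \<times> 'e) set" where
  "pairs = {(a, b). (na a, na b) \<in> relation_pairs S}"

text \<open>The coefficient of a path in an element of \<open>I\<close> is that of its image in an
  element of the ribbon ideal, so a pair found in the image is pulled back along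
  \<open>na\<close>.\<close>

lemma ideal_contains_pairs:
  assumes "f \<in> I" "f w \<noteq> 0"
  shows "contains_pair pairs (snd w)"
proof -
  obtain g where g: "g \<in> ribbon_ideal S" and f: "f = (\<lambda>(u, es). if (u, es) \<in> qpaths Q then g (nv u, map na es) else 0)"
    using assms(1) I_eq by blast
  obtain u es where w: "w = (u, es)" by (cases w)
  have "contains_pair (relation_pairs S) (snd v)" if "v \<in> ribbon_relations S" for v
    using that unfolding ribbon_relations_def contains_pair_def relation_pairs_def by force
  moreover have "g (nv u, map na es) \<noteq> 0"
    using assms(2) by (simp add: f w split: if_splits)
  ultimately have "contains_pair (relation_pairs S) (map na es)"
    using genideal_contains_pair[OF wf_ribbon_quiver finite_verts_ribbon_quiver ribbon_relations_qpaths _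
        g[unfolded ribbon_ideal_def]] by fastforce
  then show ?thesis
    unfolding contains_pair_def w pairs_def
    by (auto simp: map_eq_append_conv Cons_eq_map_conv) blast
qed

lemma nv_inv: "\<gamma> \<in> curves S \<Longrightarrow> inv_into (verts Q) nv \<gamma> \<in> verts Q \<and> nv (inv_into (verts Q) nv \<gamma>) = \<gamma>"
  using nv by (auto simp: bij_betw_def ribbon_quiver_def intro: inv_into_into f_inv_into_f)

lemma na_inv:
  assumes "P \<in> polys S" "is_corner P k"
  defines "a \<equiv> inv_into (arcs Q) na (P, k)"
  shows "a \<in> arcs Q" "na a = (P, k)"
    "tail Q a = inv_into (verts Q) nv (side_arc S P (k + 1))"
    "head Q a = inv_into (verts Q) nv (side_arc S P k)"
proof -
  interpret fin_digraph Q by (rule Q)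
  have "(P, k) \<in> na ` arcs Q"
    using assms na by (auto simp: bij_betw_def ribbon_quiver_def)
  then show a: "a \<in> arcs Q" "na a = (P, k)"
    unfolding a_def by (auto intro: inv_into_into f_inv_into_f)
  from incidence[OF a(1)] have "side_arc S P (k + 1) = nv (tail Q a)" "side_arc S P k = nv (head Q a)"
    by (simp_all add: a(2) ribbon_quiver_def)
  then show "tail Q a = inv_into (verts Q) nv (side_arc S P (k + 1))"
    "head Q a = inv_into (verts Q) nv (side_arc S P k)"
    using nv a(1) by (simp_all add: bij_betw_def)
qed

end

text \<open>At least one crossing is assumed, so that the walk is non-empty and has one vertex more
  than it has letters.\<close>

locale permissible_curve = ribbon_presentation Q I nv na S
  for Q :: "('v, 'e) pre_digraph" and I :: "(('v, 'e) qpath \<Rightarrow> 'k::field) set"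
    and nv na S +
  fixes c :: "real \<Rightarrow> 'a"
  assumes permissible: "permissible S c" and crossing: "2 \<le> segments S c"
begin

sublocale surface_curve S c
  using permissible by unfold_locales (auto simp: permissible_def minimal_crossings_def)

definition "vertex_list = map (\<lambda>j. inv_into (verts Q) nv (crossed_arc S c j)) [1..<segments S c]"

definition "letters = map (\<lambda>j. (inv_into (arcs Q) na (fst (corner_at S c j)), turns_left S c j))
  [2..<segments S c]"

lemma curve_module_eq: "curve_module Q nv na S c = string_module vertex_list letters"
  by (simp add: curve_module_def vertex_list_def letters_def)

lemma length_vertex_list: "length vertex_list = segments S c - 1"
  by (simp add: vertex_list_def)

lemma length_letters: "length letters = segments S c - 2"
  by (simp add: letters_def)

lemma nth_vertex_list:
  "j < segments S c - 1 \<Longrightarrow> vertex_list ! j = inv_into (verts Q) nv (crossed_arc S c (j + 1))"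
  by (simp add: vertex_list_def)

text \<open>Position \<open>j\<close> is the crossing \<open>j + 1\<close>; the letter after it
  belongs to the segment between the crossings \<open>j + 1\<close> and \<open>j + 2\<close>, which
  is number \<open>j + 2\<close>.\<close>

lemma nth_letters:
  "j < segments S c - 2 \<Longrightarrow>
     letters ! j = (inv_into (arcs Q) na (fst (corner_at S c (j + 2))), turns_left S c (j + 2))"
  by (simp add: letters_def add.commute)

lemma corner:
  assumes "2 \<le> j" "j < segments S c"
  obtains P k left where "crosses_corner S (segment S c j) P k left"
    "P \<in> polys S" "is_corner P k" "corner_at S c j = ((P, k), left)"
proof -
  obtain P k left where "crosses_corner S (segment S c j) P k left"
    using permissible assms unfolding permissible_def by blast
  moreover from this have "corner_at S c j = ((P, k), left)"
    using assms by (intro corner_at_unique) simp_all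
  moreover have "P \<in> polys S" "is_corner P k"
    using calculation(1) by (simp_all add: crosses_corner_def)
  ultimately show thesis by (intro that)
qed

text \<open>A left turn goes from side \<open>k + 1\<close> to side \<open>k\<close>, in the
  direction of the arrow at the corner; a right turn reads this arrow backwards.\<close>

lemma walk: "walk_in Q vertex_list letters"
  unfolding walk_in_def
proof (intro conjI allI impI)
  show "length vertex_list = Suc (length letters)"
    using crossing by (simp add: length_vertex_list length_letters)
  show "set vertex_list \<subseteq> verts Q"
    using nv_inv crossed_arc_in_curves by (auto simp: vertex_list_def)
  fix j assume "j < length letters"
  then have j: "j < segments S c - 2" "j < segments S c - 1" "Suc j < segments S c - 1"
    "2 \<le> j + 2" "j + 2 < segments S c"
    by (auto simp: length_letters)
  obtain P k left where P: "crosses_corner S (segment S c (j + 2)) P k left"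
    "P \<in> polys S" "is_corner P k" "corner_at S c (j + 2) = ((P, k), left)"
    using corner[OF j(4,5)] by blast
  show "case letters ! j of (a, d) \<Rightarrow> a \<in> arcs Q \<and>
      tail Q a = vertex_list ! (if d then j else Suc j) \<and> head Q a = vertex_list ! (if d then Suc j else j)"
    using na_inv[OF P(2,3)] crossed_arcs_at_corner[OF j(4,5) P(1)]
    unfolding nth_letters[OF j(1)] P(4)
    by (auto simp: nth_vertex_list[OF j(2)] nth_vertex_list[OF j(3)])
qed

text \<open>For two letters of the same direction in one polygon, forming a relation amounts to the
  exit side of the first corner being the entry side of the second, which
  \<open>consecutive_corners\<close> rules out.\<close>

lemma avoids: "avoids_pairs pairs letters"
  unfolding avoids_pairs_def
proof (intro allI impI)
  fix j a b assume "Suc j < length letters"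
  then have j: "j < segments S c - 2" "Suc j < segments S c - 2" "2 \<le> j + 2" "j + 2 < segments S c"
    "2 \<le> j + 3" "j + 3 < segments S c"
    by (auto simp: length_letters)
  obtain P k left where P: "crosses_corner S (segment S c (j + 2)) P k left"
    "P \<in> polys S" "is_corner P k" "corner_at S c (j + 2) = ((P, k), left)"
    using corner[OF j(3,4)] by blast
  obtain P' k' left' where P': "crosses_corner S (segment S c (j + 3)) P' k' left'"
    "P' \<in> polys S" "is_corner P' k'" "corner_at S c (j + 3) = ((P', k'), left')"
    using corner[OF j(5,6)] by blast
  have ne: "exit_side P k left \<noteq> entry_side P' k' left'" if "P = P'"
    using consecutive_corners[of "j + 2" P k left k' left'] P(1) P'(1) j that by (simp add: numeral_3_eq_3)
  have ls: "letters ! j = (inv_into (arcs Q) na (P, k), left)"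
      "letters ! Suc j = (inv_into (arcs Q) na (P', k'), left')"
    using nth_letters[OF j(1)] nth_letters[OF j(2)] P(4) P'(4) by (simp_all add: numeral_3_eq_3)
  have "(inv_into (arcs Q) na (P, k), inv_into (arcs Q) na (P', k')) \<in> pairs \<longleftrightarrow>
      P = P' \<and> k = Suc k' mod outer_sides P"
    and "(inv_into (arcs Q) na (P', k'), inv_into (arcs Q) na (P, k)) \<in> pairs \<longleftrightarrow>
      P = P' \<and> k' = Suc k mod outer_sides P"
    unfolding pairs_def using P(2,3) P'(2,3) by (auto simp: na_inv relation_pairs_def)
  with ne show "(letters ! j = (a, True) \<and> letters ! Suc j = (b, True) \<longrightarrow> (a, b) \<notin> pairs) \<and>
      (letters ! j = (a, False) \<and> letters ! Suc j = (b, False) \<longrightarrow> (b, a) \<notin> pairs)"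
    unfolding ls by (auto simp: exit_side_def entry_side_def)
qed

sublocale string_walk Q I pairs vertex_list letters
  using Q I ideal_contains_pairs walk avoids by (rule string_walk.intro)

text \<open>The two walks agree as lists, which gives an equality of modules. Crossings are counted
  from 1 and positions from 0, whence the start \<open>a - 1\<close>.\<close>

lemma curve_module_factor:
  assumes d: "crosses_exactly S c a b d" and ab: "1 \<le> a" "b < segments S c"
  shows "curve_module Q nv na S d = factor_module vertex_list letters (a - 1) (b - a + 1)"
proof -
  have d: "a \<le> b" "segments S d = b - a + 2"
    "\<And>j. a \<le> j \<Longrightarrow> j \<le> b \<Longrightarrow> crossed_arc S d (j - a + 1) = crossed_arc S c j"
    "\<And>j. a + 1 \<le> j \<Longrightarrow> j \<le> b \<Longrightarrow> corner_at S d (j - a + 1) = corner_at S c j"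
    using d unfolding crosses_exactly_def by (auto intro: corner_at_runs_along)
  have "map (\<lambda>j. inv_into (verts Q) nv (crossed_arc S d j)) [1..<segments S d] =
      take (b - a + 1) (drop (a - 1) vertex_list)"
  proof (rule nth_equalityI)
    fix j assume "j < length (map (\<lambda>j. inv_into (verts Q) nv (crossed_arc S d j)) [1..<segments S d])"
    then have j: "j < b - a + 1" by (simp add: d(2) del: upt_Suc)
    then show "map (\<lambda>j. inv_into (verts Q) nv (crossed_arc S d j)) [1..<segments S d] ! j =
        take (b - a + 1) (drop (a - 1) vertex_list) ! j"
      using ab d(1,2) d(3)[of "a + j"] nth_vertex_list[of "a - 1 + j"]
      by (simp add: length_vertex_list del: upt_Suc)
  qed (use ab d(1,2) in \<open>simp add: length_vertex_list del: upt_Suc\<close>)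
  moreover have "map (\<lambda>j. (inv_into (arcs Q) na (fst (corner_at S d j)), turns_left S d j)) [2..<segments S d] =
      take (b - a) (drop (a - 1) letters)"
  proof (rule nth_equalityI)
    fix j assume "j < length (map (\<lambda>j. (inv_into (arcs Q) na (fst (corner_at S d j)), turns_left S d j))
      [2..<segments S d])"
    then have j: "j < b - a" by (simp add: d(2) del: upt_Suc)
    then show "map (\<lambda>j. (inv_into (arcs Q) na (fst (corner_at S d j)), turns_left S d j)) [2..<segments S d] ! j =
        take (b - a) (drop (a - 1) letters) ! j"
      using ab d(1,2) d(4)[of "a + j + 1"] nth_letters[of "a - 1 + j"]
      by (simp add: length_letters del: upt_Suc)
  qed (use ab d(1,2) in \<open>simp add: length_letters del: upt_Suc\<close>)
  ultimately show ?thesis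
    by (simp add: curve_module_def factor_module_def)
qed

lemma letter_direction: "2 \<le> j \<Longrightarrow> j < segments S c \<Longrightarrow> snd (letters ! (j - 2)) = turns_left S c j"
  using nth_letters[of "j - 2"] by (simp add: le_add_diff_inverse2 del: add_2_eq_Suc')

lemma short_exact_right_turn:
  assumes i: "1 \<le> i" "i + 1 < segments S c" and right: "turns_right S c (i + 1)"
    and c': "crosses_exactly S c 1 i c'" and c'': "crosses_exactly S c (i + 1) (segments S c - 1) c''"
  shows "short_exact (bound_quiver_algebra Q I)
    (curve_module Q nv na S c') (curve_module Q nv na S c) (curve_module Q nv na S c'')"
proof -
  have c'_eq: "curve_module Q nv na S c' = factor_module vertex_list letters 0 i"
    using curve_module_factor[OF c'] i by simp
  have c''_eq: "curve_module Q nv na S c'' = factor_module vertex_list letters i (length vertex_list - i)"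
    using curve_module_factor[OF c''] i by (simp add: length_vertex_list Suc_diff_Suc numeral_2_eq_2)
  \<comment> \<open>The right turn makes the letter between \<gamma>\<open>\<^sub>i\<close> and
    \<gamma>\<open>\<^sub>i\<^sub>+\<^sub>1\<close> inverse, so it points back to the first
    \<open>i\<close> positions, which span the submodule.\<close>
  show ?thesis
    unfolding c'_eq c''_eq curve_module_eq using i right letter_direction[of "i + 1"]
    by (intro short_exact_split) (simp_all add: length_vertex_list less_diff_conv)
qed

text \<open>Index bookkeeping shared by the two dual cases: \<open>a\<close> counts the crossings
  before the middle piece, \<open>l\<close> those in it, and \<open>a + l = n\<close>.\<close>

lemma outer_factors:
  assumes mn: "2 \<le> m" "m \<le> n" "n + 1 < segments S c"
    and c': "crosses_exactly S c m n c'" and cI: "crosses_exactly S c 1 (m - 1) cI"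
    and cII: "crosses_exactly S c (n + 1) (segments S c - 1) cII"
  defines "a \<equiv> m - 1" and "l \<equiv> n - m + 1"
  shows "curve_module Q nv na S c' = factor_module vertex_list letters a l"
    and "curve_module Q nv na S cI = factor_module vertex_list letters 0 a"
    and "curve_module Q nv na S cII =
      factor_module vertex_list letters (a + l) (length vertex_list - (a + l))"
    and "0 < a" "0 < l" "a + l < length vertex_list"
    and "snd (letters ! (a - 1)) = turns_left S c m"
    and "snd (letters ! (a + l - 1)) = turns_left S c (n + 1)"
proof -
  have al: "a + l = n" using mn by (simp add: a_def l_def)
  show "curve_module Q nv na S c' = factor_module vertex_list letters a l"
    using curve_module_factor[OF c'] mn by (simp add: a_def l_def)
  show "curve_module Q nv na S cI = factor_module vertex_list letters 0 a"
  proof -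
    have "m - 1 < segments S c" "m - 1 - 1 + 1 = a" using mn by (simp_all add: a_def)
    with curve_module_factor[OF cI] show ?thesis by simp
  qed
  show "curve_module Q nv na S cII =
      factor_module vertex_list letters (a + l) (length vertex_list - (a + l))"
    using curve_module_factor[OF cII] mn
    by (simp add: al length_vertex_list Suc_diff_Suc numeral_2_eq_2)
  show "0 < a" "0 < l" "a + l < length vertex_list"
    using mn by (simp_all add: al length_vertex_list, simp_all add: a_def l_def)
  show "snd (letters ! (a - 1)) = turns_left S c m"
    using letter_direction[of m] mn by (simp add: a_def numeral_2_eq_2)
  show "snd (letters ! (a + l - 1)) = turns_left S c (n + 1)"
    using letter_direction[of "n + 1"] mn by (simp add: al)
qed

end

theorem theorem1p2:
  fixes Q :: "('v, 'e) pre_digraph"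
    and I :: "(('v, 'e) qpath \<Rightarrow> 'k::alg_closed_field) set"
    and S :: "'a ribbon_surface"
    and nv :: "'v \<Rightarrow> real \<Rightarrow> 'a"
    and na :: "'e \<Rightarrow> 'a polygon \<times> nat"
    and c :: "real \<Rightarrow> 'a"
    and r :: nat
    and A :: "(('v, 'e) qpath \<Rightarrow> 'k) set ring"
    and M :: "(real \<Rightarrow> 'a) \<Rightarrow> ((('v, 'e) qpath \<Rightarrow> 'k) set, nat \<Rightarrow> 'k) module"
  assumes gentle: "gentle Q I"
    and surface: "ribbon_surface_of Q I nv na S"
    and c: "permissible S c"
    and r: "r = segments S c"
    and A: "A = bound_quiver_algebra Q I"
    and M: "M = curve_module Q nv na S"
  shows
    "(\<forall>i c' c''.
        1 \<le> i \<and> i + 1 \<le> r - 1 \<and> turns_right S c (i + 1) \<and>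
        permissible S c' \<and> crosses_exactly S c 1 i c' \<and>
          starts_along S c c' \<and> ends_opposite S c (i + 1) c' \<and>
        permissible S c'' \<and> crosses_exactly S c (i + 1) (r - 1) c'' \<and>
          starts_opposite S c (i + 1) c'' \<and> ends_along S c c''
        \<longrightarrow> short_exact A (M c') (M c) (M c''))
     \<and>
     (\<forall>m i n p q c' cI cII.
        2 \<le> m \<and> m < i \<and> i < n \<and> n + 2 \<le> r \<and>
        left_endpoint S c i p \<and> right_endpoint S c i q \<and>
        (\<forall>j\<in>{m..i}. corner_point S c j = p \<and> turns_left S c j) \<and>
        (\<forall>j\<in>{i+1..n+1}. corner_point S c j = q \<and> turns_right S c j) \<and>
        permissible S c' \<and> crosses_exactly S c m n c' \<and>
          starts_opposite S c m c' \<and> ends_opposite S c (n + 1) c' \<and>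
        permissible S cI \<and> crosses_exactly S c 1 (m - 1) cI \<and>
          starts_along S c cI \<and> ends_opposite S c m cI \<and>
        permissible S cII \<and> crosses_exactly S c (n + 1) (r - 1) cII \<and>
          starts_opposite S c (n + 1) cII \<and> ends_along S c cII
        \<longrightarrow> short_exact A (M c') (M c) (module_sum (M cI) (M cII)))
     \<and>
     (\<forall>m i n p q c'' cI cII.
        2 \<le> m \<and> m < i \<and> i < n \<and> n + 2 \<le> r \<and>
        right_endpoint S c i p \<and> left_endpoint S c i q \<and>
        (\<forall>j\<in>{m..i}. corner_point S c j = p \<and> turns_right S c j) \<and>
        (\<forall>j\<in>{i+1..n+1}. corner_point S c j = q \<and> turns_left S c j) \<and>
        permissible S c'' \<and> crosses_exactly S c m n c'' \<and>
          starts_opposite S c m c'' \<and> ends_opposite S c (n + 1) c'' \<and>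
        permissible S cI \<and> crosses_exactly S c 1 (m - 1) cI \<and>
          starts_along S c cI \<and> ends_opposite S c m cI \<and>
        permissible S cII \<and> crosses_exactly S c (n + 1) (r - 1) cII \<and>
          starts_opposite S c (n + 1) cII \<and> ends_along S c cII
        \<longrightarrow> short_exact A (module_sum (M cI) (M cII)) (M c) (M c''))"
proof -
  \<comment> \<open>In each case the index bounds force a crossing, so the locale is entered only
    there.\<close>
  have curve: "permissible_curve Q I nv na S c" if "2 \<le> r"
  proof (intro permissible_curve.intro permissible_curve_axioms.intro ribbon_presentation.intro
      ribbon_presentation_axioms.intro marked_surface.intro)
    show "fin_digraph Q" "ideal I (path_algebra Q)"
      using gentle by (simp_all add: gentle_def admissible_ideal_def)
    show "marked_ribbon_surface S" "bij_betw nv (verts Q) (verts (ribbon_quiver S))"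
      "bij_betw na (arcs Q) (arcs (ribbon_quiver S))"
      "I = (\<lambda>f (u, es). if (u, es) \<in> qpaths Q then f (nv u, map na es) else 0) ` ribbon_ideal S"
      using surface by (simp_all only: ribbon_surface_of_def)
    show "tail (ribbon_quiver S) (na a) = nv (tail Q a) \<and> head (ribbon_quiver S) (na a) = nv (head Q a)"
      if "a \<in> arcs Q" for a
      using surface that by (simp add: ribbon_surface_of_def)
    show "permissible S c" "2 \<le> segments S c" using c that r by simp_all
  qed
  show ?thesis
    unfolding A M r
  proof (intro conjI allI impI; elim conjE)
    fix i c' c''
    assume *: "1 \<le> i" "i + 1 \<le> segments S c - 1" "turns_right S c (i + 1)"
      "crosses_exactly S c 1 i c'" "crosses_exactly S c (i + 1) (segments S c - 1) c''"
    then interpret permissible_curve Q I nv na S c using r by (intro curve) simp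
    show "short_exact (bound_quiver_algebra Q I)
      (curve_module Q nv na S c') (curve_module Q nv na S c) (curve_module Q nv na S c'')"
      using * by (intro short_exact_right_turn) simp_all
  next
    fix m i n p q c' cI cII
    assume *: "2 \<le> m" "m < i" "i < n" "n + 2 \<le> segments S c"
      "\<forall>j\<in>{m..i}. corner_point S c j = p \<and> turns_left S c j"
      "\<forall>j\<in>{i+1..n+1}. corner_point S c j = q \<and> turns_right S c j"
      "crosses_exactly S c m n c'" "crosses_exactly S c 1 (m - 1) cI"
      "crosses_exactly S c (n + 1) (segments S c - 1) cII"
    then interpret permissible_curve Q I nv na S c using r by (intro curve) simp
    have mn: "2 \<le> m" "m \<le> n" "n + 1 < segments S c" using * by simp_all
    note o = outer_factors[OF mn *(7-9)]
    show "short_exact (bound_quiver_algebra Q I) (curve_module Q nv na S c') (curve_module Q nv na S c)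
      (module_sum (curve_module Q nv na S cI) (curve_module Q nv na S cII))"
      \<comment> \<open>The two ranges contain \<open>m\<close> and \<open>n + 1\<close>, the
        indices of the cut letters: left at \<open>m\<close> and right at \<open>n + 1\<close> means
        that both point inwards.\<close>
      unfolding o(1-3) curve_module_eq using * o(4-8)
      by (intro short_exact_inner_submodule) simp_all
  next
    fix m i n p q c'' cI cII
    assume *: "2 \<le> m" "m < i" "i < n" "n + 2 \<le> segments S c"
      "\<forall>j\<in>{m..i}. corner_point S c j = p \<and> turns_right S c j"
      "\<forall>j\<in>{i+1..n+1}. corner_point S c j = q \<and> turns_left S c j"
      "crosses_exactly S c m n c''" "crosses_exactly S c 1 (m - 1) cI"
      "crosses_exactly S c (n + 1) (segments S c - 1) cII"
    then interpret permissible_curve Q I nv na S c using r by (intro curve) simp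
    have mn: "2 \<le> m" "m \<le> n" "n + 1 < segments S c" using * by simp_all
    note o = outer_factors[OF mn *(7-9)]
    show "short_exact (bound_quiver_algebra Q I)
      (module_sum (curve_module Q nv na S cI) (curve_module Q nv na S cII))
      (curve_module Q nv na S c) (curve_module Q nv na S c'')"
      \<comment> \<open>Now the turns at \<open>m\<close> and \<open>n + 1\<close> are right and
        left, so both cut letters point outwards.\<close>
      unfolding o(1-3) curve_module_eq using * o(4-8)
      by (intro short_exact_inner_quotient) simp_all
  qed
qed

end
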